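(* Let $\sigma>0$ and let $T\ge 1$ be an integer. Let $e_t\in\mathbb{R}^T$ denote the $t$-th standard basis vector, $I_T$ the $T\times T$ identity matrix, and define the probability distributions on $\mathbb{R}^T$ $$P_{\mathcal B} := \sum_{t=1}^T \frac1T\,\mathcal N(e_t,\sigma^2 I_T),\qquad Q_{\mathcal B}:=\mathcal N(0,\sigma^2 I_T).$$ Then $(P_{\mathcal B},Q_{\mathcal B})$ tightly dominates the mechanism $\mathrm{ABLQ}_{\mathcal B}$ (Adaptive Batch Linear Queries with the Balls-and-Bins batch generator with $T$ batches and noise scale $\sigma$). That is, for every number $n\ge 1$ of records: (i) $(P_{\mathcal B},Q_{\mathcal B})$ dominates $\mathrm{ABLQ}_{\mathcal B}$: for every data domain $\mathcal X$, every dimension $d\ge1$, every adaptive query method $\mathcal A$, and all $\boldsymbol x\to_z\boldsymbol x'$ in $\mathcal X_\bot^n$, it holds for all $\varepsilon\in\mathbb R$ that $D_{e^\varepsilon}(P_{\mathcal B}\,\|\,Q_{\mathcal B})\ge D_{e^\varepsilon}(\mathrm{ABLQ}_{\mathcal B}(\boldsymbol x)\,\|\,\mathrm{ABLQ}_{\mathcal B}(\boldsymbol x'))$; and (ii) $\mathrm{ABLQ}_{\mathcal B}$ dominates $(P_{\mathcal B},Q_{\mathcal B})$: there exist a data domain $\mathcal X$, a dimension $d\ge 1$, an adaptive query method $\mathcal A$, and $\boldsymbol x\to_z\boldsymbol x'$ in $\mathcal X_\bot^n$ such that for all $\varepsilon\in\mathbb R$, $D_{e^\varepsilon}(\mathrm{ABLQ}_{\mathcal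 B}(\boldsymbol x)\,\|\,\mathrm{ABLQ}_{\mathcal B}(\boldsymbol x'))\ge D_{e^\varepsilon}(P_{\mathcal B}\,\|\,Q_{\mathcal B})$.
   Context: Hockey stick divergence: for probability distributions $P,Q$ on the same space and $\varepsilon\in\mathbb R$, $D_{e^\varepsilon}(P\,\|\,Q):=\sup_{\Gamma}\,P(\Gamma)-e^{\varepsilon}Q(\Gamma)$, the supremum being over measurable events $\Gamma$. A sum $\sum_t \alpha_t P_t$ of distributions denotes the mixture. Adaptive query method: let $\mathbb B^d:=\{v\in\mathbb R^d:\|v\|_2\le 1\}$. An adaptive query method is a map $\mathcal A:(\mathbb R^d)^*\times\mathcal X\to\mathbb B^d$ (where $(\mathbb R^d)^*$ is the set of finite sequences in $\mathbb R^d$), assumed measurable in the first argument. Let $\mathcal X_\bot:=\mathcal X\cup\{\bot\}$; $\mathcal A$ is extended by $\mathcal A(g_1,\dots,g_t;\bot)=\mathbf 0$ for all $g_1,\dots,g_t$. Zeroing-out adjacency: for $\boldsymbol x,\boldsymbol x'\in\mathcal X_\bot^n$, write $\boldsymbol x\to_z\boldsymbol x'$ if there is an index $i$ such that $x_j=x'_j$ for all $j\neq i$, $x_i\in\mathcal X$ and $x'_i=\bot$. Balls-and-Bins batch generator $\mathcal B$ with $T$ batches: on input $n$, each $i\in[n]$ is independently placed in exactly one batch $S_t$ with $t$ uniformly random in $[T]$; the output is the (random) sequence $(S_1,\dots,S_T)$ of subsets of $[n]$. Mechanism $\mathrm{ABLQ}_{\mathcal B}$ (with parameters $\sigma$, $\mathcal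 A$): on input $\boldsymbol x=(x_1,\dots,x_n)$, draw $(S_1,\dots,S_T)$ from $\mathcal B$; for $t=1,\dots,T$ in order, set $\psi_t(\cdot):=\mathcal A(g_1,\dots,g_{t-1};\cdot)$ and $g_t:=\sum_{i\in S_t}\psi_t(x_i)+\xi_t$ with fresh independent noise $\xi_t\sim\mathcal N(0,\sigma^2 I_d)$; output $(g_1,\dots,g_T)\in(\mathbb R^d)^T$. $\mathrm{ABLQ}_{\mathcal B}(\boldsymbol x)$ denotes the distribution of the output. *)

theory Defs
  imports "HOL-Probability.Probability"
begin

text \<open>
  Dimensions and sequence lengths are natural numbers, so that they can be quantified over.
  A vector of \<open>\<real>\<^sup>d\<close> is an extensional function on \<open>{..<d}\<close>; batches, records and coordinates are
  numbered from 0.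
\<close>

abbreviation euclid :: "nat \<Rightarrow> (nat \<Rightarrow> real) measure" where
  "euclid d \<equiv> PiM {..<d} (\<lambda>_. borel)"

definition unit_ball :: "nat \<Rightarrow> (nat \<Rightarrow> real) set" where
  "unit_ball d = {v \<in> space (euclid d). L2_set v {..<d} \<le> 1}"

text \<open>
  The isotropic Gaussian \<open>\<N>(\<mu>, \<sigma>\<^sup>2 I\<^sub>d)\<close>, i.e. independent coordinates; only the values of \<open>\<mu>\<close>
  on \<open>{..<d}\<close> matter. The second argument of \<open>normal_density\<close> is the standard deviation.
\<close>

definition gaussian :: "nat \<Rightarrow> (nat \<Rightarrow> real) \<Rightarrow> real \<Rightarrow> (nat \<Rightarrow> real) measure" where
  "gaussian d \<mu> \<sigma> = PiM {..<d} (\<lambda>j. density lborel (normal_density (\<mu> j) \<sigma>))"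

definition std_basis :: "nat \<Rightarrow> nat \<Rightarrow> real" where
  "std_basis t = (\<lambda>j. if j = t then 1 else 0)"

definition hockey_stick :: "real \<Rightarrow> 'a measure \<Rightarrow> 'a measure \<Rightarrow> real" where
  "hockey_stick \<alpha> P Q = (SUP \<Gamma>\<in>sets P. measure P \<Gamma> - \<alpha> * measure Q \<Gamma>)"

text \<open>
  Histories are lists. Since lists carry no sigma-algebra, measurability in the first
  argument is required on \<open>(\<real>\<^sup>d)\<^sup>t\<close> for each length \<open>t\<close>.
\<close>

definition adaptive_query_method ::
    "nat \<Rightarrow> 'x set \<Rightarrow> ((nat \<Rightarrow> real) list \<Rightarrow> 'x \<Rightarrow> nat \<Rightarrow> real) \<Rightarrow> bool" where
  "adaptive_query_method d X A \<longleftrightarrow>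
     (\<forall>gs\<in>lists (space (euclid d)). \<forall>r\<in>X. A gs r \<in> unit_ball d) \<and>
     (\<forall>t. \<forall>r\<in>X. (\<lambda>g. A (map g [0..<t]) r) \<in> PiM {..<t} (\<lambda>_. euclid d) \<rightarrow>\<^sub>M euclid d)"

text \<open>The extension of a query method to \<open>X \<union> {\<bottom>}\<close>, with \<open>\<bottom>\<close> represented by \<open>None\<close>.\<close>

definition extend_query ::
    "nat \<Rightarrow> ((nat \<Rightarrow> real) list \<Rightarrow> 'x \<Rightarrow> nat \<Rightarrow> real) \<Rightarrow> (nat \<Rightarrow> real) list \<Rightarrow> 'x option \<Rightarrow> nat \<Rightarrow> real"
  where
  "extend_query d A gs r = (case r of None \<Rightarrow> (\<lambda>j\<in>{..<d}. 0) | Some y \<Rightarrow> A gs y)"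

definition datasets :: "'x set \<Rightarrow> nat \<Rightarrow> 'x option list set" where
  "datasets X n = {x. length x = n \<and> set x \<subseteq> insert None (Some ` X)}"

definition zeroing_adjacent :: "'x set \<Rightarrow> 'x option list \<Rightarrow> 'x option list \<Rightarrow> bool" where
  "zeroing_adjacent X x x' \<longleftrightarrow> length x = length x' \<and>
     (\<exists>i<length x. x ! i \<in> Some ` X \<and> x' ! i = None \<and> (\<forall>j<length x. j \<noteq> i \<longrightarrow> x ! j = x' ! j))"

text \<open>
  A batch generator maps the number of records to a random sequence of batches. The function
  \<open>b\<close> below sends each record to its bin; the \<open>0\<close> is only the value of \<open>b\<close> outside \<open>{..<n}\<close>.
\<close>

definition balls_and_bins :: "nat \<Rightarrow> nat \<Rightarrow> nat set list pmf" where
  "balls_and_bins T n =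
     map_pmf (\<lambda>b. map (\<lambda>t. {i. i < n \<and> b i = t}) [0..<T])
       (Pi_pmf {..<n} 0 (\<lambda>_. pmf_of_set {..<T}))"

text \<open>
  The list \<open>[g\<^sub>0, \<dots>, g\<^bsub>t-1\<^esub>]\<close> of answers as a function of the batches \<open>S\<close> and the noise \<open>\<xi>\<close>.
  Intersecting with \<open>{..<length x}\<close> does nothing on batches that a generator can output; it keeps
  the function measurable in \<open>\<xi>\<close> for all other \<open>S\<close>, as \<open>bind\<close> below requires.
\<close>

primrec ablq_answers ::
    "nat \<Rightarrow> ((nat \<Rightarrow> real) list \<Rightarrow> 'x \<Rightarrow> nat \<Rightarrow> real) \<Rightarrow> 'x option list \<Rightarrow> nat set list \<Rightarrow>
     (nat \<Rightarrow> nat \<Rightarrow> real) \<Rightarrow> nat \<Rightarrow> (nat \<Rightarrow> real) list" where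
  "ablq_answers d A x S \<xi> 0 = []"
| "ablq_answers d A x S \<xi> (Suc t) =
     (let gs = ablq_answers d A x S \<xi> t; \<psi> = extend_query d A gs
      in gs @ [\<lambda>j\<in>{..<d}. (\<Sum>i\<in>S ! t \<inter> {..<length x}. \<psi> (x ! i) j) + \<xi> t j])"

definition ablq ::
    "(nat \<Rightarrow> nat set list pmf) \<Rightarrow> nat \<Rightarrow> real \<Rightarrow> nat \<Rightarrow>
     ((nat \<Rightarrow> real) list \<Rightarrow> 'x \<Rightarrow> nat \<Rightarrow> real) \<Rightarrow> 'x option list \<Rightarrow> (nat \<Rightarrow> nat \<Rightarrow> real) measure" where
  "ablq B T \<sigma> d A x =
     measure_pmf (B (length x)) \<bind>
       (\<lambda>S. distr (PiM {..<T} (\<lambda>_. gaussian d (\<lambda>_. 0) \<sigma>)) (PiM {..<T} (\<lambda>_. euclid d))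
              (\<lambda>\<xi>. \<lambda>t\<in>{..<T}. ablq_answers d A x S \<xi> T ! t))"

definition P_bb :: "nat \<Rightarrow> real \<Rightarrow> (nat \<Rightarrow> real) measure" where
  "P_bb T \<sigma> = measure_pmf (pmf_of_set {..<T}) \<bind> (\<lambda>t. gaussian T (std_basis t) \<sigma>)"

definition Q_bb :: "nat \<Rightarrow> real \<Rightarrow> (nat \<Rightarrow> real) measure" where
  "Q_bb T \<sigma> = gaussian T (\<lambda>_. 0) \<sigma>"

text \<open>
  The uses of \<open>bind\<close> and \<open>distr\<close> above are well-behaved: \<open>P_bb\<close> is the intended mixture, and
  \<open>ablq\<close> is a probability measure on \<open>(\<real>\<^sup>d)\<^sup>T\<close>.
\<close>

lemma sets_gaussian: "sets (gaussian d \<mu> \<sigma>) = sets (euclid d)"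
  unfolding gaussian_def by (rule sets_PiM_cong) auto
lemma prob_space_gaussian: "\<sigma> > 0 \<Longrightarrow> prob_space (gaussian d \<mu> \<sigma>)"
  unfolding gaussian_def by (intro prob_space_PiM prob_space_normal_density)
lemma measure_P_bb:
  assumes "\<sigma> > 0" "T \<ge> 1" "\<Gamma> \<in> sets (euclid T)"
  shows "measure (P_bb T \<sigma>) \<Gamma> = (\<Sum>t<T. 1 / real T * measure (gaussian T (std_basis t) \<sigma>) \<Gamma>)"
proof -
  interpret p: prob_space "gaussian T (std_basis t) \<sigma>" for t by (rule prob_space_gaussian[OF assms(1)])
  have "{..<T} \<noteq> {}" using assms by (auto simp: lessThan_empty_iff)
  moreover have K: "(\<lambda>t. gaussian T (std_basis t) \<sigma>) \<in> measurable (measure_pmf (pmf_of_set {..<T})) (subprob_algebra (euclid T))"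
    by (auto simp: space_subprob_algebra sets_gaussian p.subprob_space_axioms intro!: measurable_measure_pmf)
  ultimately show ?thesis unfolding P_bb_def
    by (subst subprob_space.measure_bind[OF _ K assms(3)])
       (auto simp: measure_pmf.subprob_space_axioms integral_pmf_of_set sum_divide_distrib)
qed

lemma length_ablq_answers: "length (ablq_answers d A x S \<xi> t) = t"
  by (induction t) (auto simp: Let_def)
lemma nth_ablq_answers: "s < t \<Longrightarrow> ablq_answers d A x S \<xi> t ! s = ablq_answers d A x S \<xi> (Suc s) ! s"
  by (induction t) (auto simp: Let_def nth_append length_ablq_answers less_Suc_eq)

lemma measurable_ablq_answers:
  assumes A: "adaptive_query_method d X A" and x: "x \<in> datasets X n"
  shows "t < T \<Longrightarrow> (\<lambda>\<xi>. ablq_answers d A x S \<xi> (Suc t) ! t) \<in> PiM {..<T} (\<lambda>_. euclid d) \<rightarrow>\<^sub>M euclid d"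
proof (induction t rule: less_induct)
  case (less t)
  have eq: "ablq_answers d A x S \<xi> t = map (\<lambda>s\<in>{..<t}. ablq_answers d A x S \<xi> (Suc s) ! s) [0..<t]" for \<xi>
    by (intro nth_equalityI) (auto simp: length_ablq_answers simp del: ablq_answers.simps intro: nth_ablq_answers)
  have h: "(\<lambda>\<xi>. \<lambda>s\<in>{..<t}. ablq_answers d A x S \<xi> (Suc s) ! s) \<in> PiM {..<T} (\<lambda>_. euclid d) \<rightarrow>\<^sub>M PiM {..<t} (\<lambda>_. euclid d)"
    by (rule measurable_restrict) (use less in auto)
  have q: "(\<lambda>\<xi>. extend_query d A (ablq_answers d A x S \<xi> t) (x ! i)) \<in> PiM {..<T} (\<lambda>_. euclid d) \<rightarrow>\<^sub>M euclid d"
    if "i < length x" for i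
  proof (cases "x ! i")
    case None
    then show ?thesis by (simp add: extend_query_def space_PiM)
  next
    case (Some y)
    hence "y \<in> X" using x that nth_mem[OF that] by (auto simp: datasets_def)
    hence "(\<lambda>g. A (map g [0..<t]) y) \<in> PiM {..<t} (\<lambda>_. euclid d) \<rightarrow>\<^sub>M euclid d"
      using A by (auto simp: adaptive_query_method_def)
    from measurable_compose[OF h this] show ?thesis
      unfolding extend_query_def Some option.case eq[symmetric] .
  qed
  have q': "(\<lambda>\<xi>. extend_query d A (ablq_answers d A x S \<xi> t) (x ! i) j) \<in> borel_measurable (PiM {..<T} (\<lambda>_. euclid d))"
    if "i < length x" "j < d" for i j
    by (rule measurable_compose[OF q[OF that(1)] measurable_component_singleton]) (use that in auto)
  have x': "(\<lambda>\<xi>. \<xi> t j) \<in> borel_measurable (PiM {..<T} (\<lambda>_. euclid d))" if "j < d" for j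
    using that less by (intro measurable_compose[where f = "\<lambda>\<xi>. \<xi> t" and g = "\<lambda>v. v j" and N = "euclid d"]
      measurable_component_singleton) auto
  show ?case
    unfolding ablq_answers.simps Let_def nth_append length_ablq_answers
    by (simp only: less_irrefl if_False diff_self_eq_0 nth_Cons_0, rule measurable_restrict)
       (auto intro!: borel_measurable_add borel_measurable_sum q' x')
qed

lemma ablq_prob_space:
  assumes "\<sigma> > 0" and A: "adaptive_query_method d X A" and x: "x \<in> datasets X n"
  shows "prob_space (ablq B T \<sigma> d A x)" "sets (ablq B T \<sigma> d A x) = sets (PiM {..<T} (\<lambda>_. euclid d))"
proof -
  let ?N = "PiM {..<T} (\<lambda>_. gaussian d (\<lambda>_. 0) \<sigma>)" and ?M = "PiM {..<T} (\<lambda>_. euclid d)"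
  have s: "sets ?N = sets ?M" by (rule sets_PiM_cong) (auto simp: sets_gaussian)
  have m: "(\<lambda>\<xi>. \<lambda>t\<in>{..<T}. ablq_answers d A x S \<xi> T ! t) \<in> ?N \<rightarrow>\<^sub>M ?M" for S
    unfolding measurable_cong_sets[OF s refl]
    by (rule measurable_restrict, subst nth_ablq_answers, simp, rule measurable_ablq_answers[OF A x]) simp
  have p: "prob_space (distr ?N ?M (\<lambda>\<xi>. \<lambda>t\<in>{..<T}. ablq_answers d A x S \<xi> T ! t))" for S
    by (rule prob_space.prob_space_distr[OF _ m]) (intro prob_space_PiM prob_space_gaussian assms)
  have K: "(\<lambda>S. distr ?N ?M (\<lambda>\<xi>. \<lambda>t\<in>{..<T}. ablq_answers d A x S \<xi> T ! t)) \<in> measurable (measure_pmf (B (length x))) (subprob_algebra ?M)"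
    using p by (auto simp: space_subprob_algebra intro!: prob_space_imp_subprob_space)
  show "prob_space (ablq B T \<sigma> d A x)" unfolding ablq_def
    by (rule measure_pmf.prob_space_bind[OF _ K]) (simp add: p)
  show "sets (ablq B T \<sigma> d A x) = sets ?M" unfolding ablq_def
    by (rule sets_bind) auto
qed
end

theory Submission
  imports Defs
begin

text \<open>
  Fix the bins of all records but the differing one. Relative to the run on the zeroed-out data set,
  placing the differing record in bin \<open>t\<close> shifts the noise \<open>\<xi>\<^sub>t\<close> by a vector \<open>u\<^sub>t\<close> of norm at most 1
  that is a function of the earlier noise, so the likelihood ratio is
  \<open>L\<^sub>t = exp ((\<langle>u\<^sub>t, \<xi>\<^sub>t\<rangle> - \<parallel>u\<^sub>t\<parallel>\<^sup>2 / 2) / \<sigma>\<^sup>2)\<close>, and the divergence is at most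
  \<open>E (1/T \<Sum> L\<^sub>t - c)\<^sub>+\<close>. The noise is integrated out from the last batch to the first: for a convex
  function \<open>F\<close>, Jensen's inequality bounds \<open>E F (a + w L\<^sub>t)\<close> by its value for a unit vector \<open>u\<^sub>t\<close>,
  where \<open>\<langle>u\<^sub>t, \<xi>\<^sub>t\<rangle>\<close> is a one-dimensional Gaussian whatever the direction of \<open>u\<^sub>t\<close>. What results is
  \<open>E (1/T \<Sum> exp ((z\<^sub>t - 1/2) / \<sigma>\<^sup>2) - c)\<^sub>+\<close> for independent Gaussians \<open>z\<^sub>t\<close>, which is the divergence
  of \<open>P_bb\<close> from \<open>Q_bb\<close>. Conversely, the constant query 1 in dimension 1, on a data set with a single
  record different from \<open>\<bottom>\<close>, reproduces the pair exactly.
\<close>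

section \<open>Gaussian measures\<close>

abbreviation normal :: "real \<Rightarrow> real \<Rightarrow> real measure" where
  "normal \<mu> \<sigma> \<equiv> density lborel (\<lambda>x. ennreal (normal_density \<mu> \<sigma> x))"

text \<open>The preimage of a box under a coordinatewise map is again a box, so both measures give
  every box the same product of masses. It serves twice: to shift a Gaussian vector, and to read
  one-dimensional noise vectors as a single vector in the tightness part.\<close>

lemma distr_PiM_coordinatewise:
  assumes I: "finite I" and M: "\<And>i. prob_space (M i)"
    and f: "\<And>i. f i \<in> M i \<rightarrow>\<^sub>M N i"
  shows "distr (PiM I M) (PiM I N) (\<lambda>x. \<lambda>i\<in>I. f i (x i)) = PiM I (\<lambda>i. distr (M i) (N i) (f i))"
proof -
  interpret M: prob_space "M i" for i by (rule M)
  interpret M: product_sigma_finite M by standard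
  interpret D: prob_space "distr (M i) (N i) (f i)" for i by (rule M.prob_space_distr[OF f])
  interpret D: product_sigma_finite "\<lambda>i. distr (M i) (N i) (f i)" by standard
  note f[measurable]
  have meas: "(\<lambda>x. \<lambda>i\<in>I. f i (x i)) \<in> PiM I M \<rightarrow>\<^sub>M PiM I N"
    by (intro measurable_restrict) measurable
  show ?thesis
  proof (rule D.PiM_eqI[OF I])
    show "sets (distr (PiM I M) (PiM I N) (\<lambda>x. \<lambda>i\<in>I. f i (x i))) =
        sets (PiM I (\<lambda>i. distr (M i) (N i) (f i)))"
      by (simp, rule sets_PiM_cong) auto
  next
    fix A assume "\<And>i. i \<in> I \<Longrightarrow> A i \<in> sets (distr (M i) (N i) (f i))"
    hence A: "\<And>i. i \<in> I \<Longrightarrow> A i \<in> sets (N i)" by simp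
    have "emeasure (distr (PiM I M) (PiM I N) (\<lambda>x. \<lambda>i\<in>I. f i (x i))) (Pi\<^sub>E I A) =
        emeasure (PiM I M) ((\<lambda>x. \<lambda>i\<in>I. f i (x i)) -` Pi\<^sub>E I A \<inter> space (PiM I M))"
      by (rule emeasure_distr[OF meas]) (use A I in auto)
    also have "(\<lambda>x. \<lambda>i\<in>I. f i (x i)) -` Pi\<^sub>E I A \<inter> space (PiM I M) =
        Pi\<^sub>E I (\<lambda>i. f i -` A i \<inter> space (M i))"
      by (auto simp: space_PiM PiE_iff)
    also have "emeasure (PiM I M) \<dots> = (\<Prod>i\<in>I. emeasure (M i) (f i -` A i \<inter> space (M i)))"
      by (rule M.emeasure_PiM[OF I]) (use A in \<open>auto intro!: measurable_sets[OF f]\<close>)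
    also have "\<dots> = (\<Prod>i\<in>I. emeasure (distr (M i) (N i) (f i)) (A i))"
      by (intro prod.cong refl) (simp add: emeasure_distr[OF f] A)
    finally show "emeasure (distr (PiM I M) (PiM I N) (\<lambda>x. \<lambda>i\<in>I. f i (x i))) (Pi\<^sub>E I A) =
        (\<Prod>i\<in>I. emeasure (distr (M i) (N i) (f i)) (A i))" .
  qed
qed

lemma distr_normal_affine:
  assumes "\<sigma> > 0" "\<alpha> \<noteq> 0"
  shows "distr (normal 0 \<sigma>) borel (\<lambda>z. \<alpha> * z + \<beta>) = normal \<beta> (\<bar>\<alpha>\<bar> * \<sigma>)"
proof -
  interpret prob_space "normal 0 \<sigma>" by (rule prob_space_normal_density[OF assms(1)])
  have "distributed (normal 0 \<sigma>) lborel (\<lambda>x. x) (normal_density 0 \<sigma>)"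
    by (auto simp: distributed_def distr_id2)
  from normal_density_affine[OF this assms, of \<beta>]
  have "distr (normal 0 \<sigma>) lborel (\<lambda>x. \<beta> + \<alpha> * x) = normal \<beta> (\<bar>\<alpha>\<bar> * \<sigma>)"
    by (simp add: distributed_def)
  moreover have "distr (normal 0 \<sigma>) lborel (\<lambda>x. \<beta> + \<alpha> * x) = distr (normal 0 \<sigma>) borel (\<lambda>z. \<alpha> * z + \<beta>)"
    by (intro distr_cong) (auto simp: add.commute)
  ultimately show ?thesis by simp
qed

text \<open>The likelihood ratio at \<open>z\<close> of the Gaussian centred at \<open>u\<close>
  against the centred one; \<open>gaussian_tilt\<close> justifies this reading.\<close>

definition gauss_lr :: "nat \<Rightarrow> real \<Rightarrow> (nat \<Rightarrow> real) \<Rightarrow> (nat \<Rightarrow> real) \<Rightarrow> real" where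
  "gauss_lr d \<sigma> u z = exp (((\<Sum>j<d. u j * z j) - (\<Sum>j<d. (u j)\<^sup>2) / 2) / \<sigma>\<^sup>2)"

text \<open>Expand the square in the exponent of the density: the cross term and the constant term
  split off as the exponential factor.\<close>

lemma normal_tilt:
  assumes "\<sigma> > 0"
  shows "normal \<mu> \<sigma> = density (normal 0 \<sigma>) (\<lambda>z. ennreal (exp ((\<mu> * z - \<mu>\<^sup>2 / 2) / \<sigma>\<^sup>2)))"
proof -
  have "normal_density \<mu> \<sigma> z = normal_density 0 \<sigma> z * exp ((\<mu> * z - \<mu>\<^sup>2 / 2) / \<sigma>\<^sup>2)" for z
  proof -
    have "-(z - \<mu>)\<^sup>2 / (2 * \<sigma>\<^sup>2) = -(z - 0)\<^sup>2 / (2 * \<sigma>\<^sup>2) + (\<mu> * z - \<mu>\<^sup>2 / 2) / \<sigma>\<^sup>2"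
      using assms by (simp add: field_simps power2_eq_square)
    thus ?thesis unfolding normal_density_def by (simp only: exp_add)
  qed
  thus ?thesis
    by (subst density_density_eq) (auto simp: ennreal_mult[symmetric] normal_density_nonneg)
qed

lemma gaussian_shift:
  assumes "\<sigma> > 0"
  shows "distr (gaussian d (\<lambda>_. 0) \<sigma>) (euclid d) (\<lambda>z. \<lambda>j\<in>{..<d}. z j + \<mu> j) = gaussian d \<mu> \<sigma>"
  using distr_normal_affine[OF assms, of 1] unfolding gaussian_def
  by (subst distr_PiM_coordinatewise) (auto intro: prob_space_normal_density assms)

lemma gauss_lr_measurable [measurable]:
  "gauss_lr d \<sigma> u \<in> borel_measurable (euclid d)"
  unfolding gauss_lr_def by measurable

lemma measurable_gaussian_cong: "measurable (gaussian d \<mu> \<sigma>) N = measurable (euclid d) N"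
  by (rule measurable_cong_sets[OF sets_gaussian refl])

text \<open>The ratio factors over the coordinates, so on boxes the claim reduces to
  \<open>normal_tilt\<close> in each coordinate.\<close>

lemma gaussian_tilt:
  assumes "\<sigma> > 0"
  shows "gaussian d \<mu> \<sigma> = density (gaussian d (\<lambda>_. 0) \<sigma>) (\<lambda>z. ennreal (gauss_lr d \<sigma> \<mu> z))"
proof -
  interpret N: prob_space "normal m \<sigma>" for m by (rule prob_space_normal_density[OF assms])
  interpret P: product_sigma_finite "\<lambda>j. normal (\<mu> j) \<sigma>" by standard
  interpret Q: product_sigma_finite "\<lambda>j::nat. normal 0 \<sigma>" by standard
  let ?D = "density (gaussian d (\<lambda>_. 0) \<sigma>) (\<lambda>z. ennreal (gauss_lr d \<sigma> \<mu> z))"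
  have lr: "ennreal (gauss_lr d \<sigma> \<mu> z) = (\<Prod>j<d. ennreal (exp ((\<mu> j * z j - (\<mu> j)\<^sup>2 / 2) / \<sigma>\<^sup>2)))" for z
    by (simp add: gauss_lr_def prod_ennreal exp_sum[symmetric] sum_subtractf sum_divide_distrib diff_divide_distrib)
  have "?D = PiM {..<d} (\<lambda>j. normal (\<mu> j) \<sigma>)"
  proof (rule P.PiM_eqI)
    show "sets ?D = sets (PiM {..<d} (\<lambda>j. normal (\<mu> j) \<sigma>))"
      by (simp add: sets_gaussian, rule sets_PiM_cong) auto
  next
    fix A assume A0: "\<And>j. j \<in> {..<d} \<Longrightarrow> A j \<in> sets (normal (\<mu> j) \<sigma>)"
    hence A: "\<And>j. j < d \<Longrightarrow> A j \<in> sets borel" by simp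
    have "Pi\<^sub>E {..<d} A \<in> sets (euclid d)" using A by (auto intro!: sets_PiM_I_finite)
    hence "emeasure ?D (Pi\<^sub>E {..<d} A) =
        (\<integral>\<^sup>+z. ennreal (gauss_lr d \<sigma> \<mu> z) * indicator (Pi\<^sub>E {..<d} A) z \<partial>gaussian d (\<lambda>_. 0) \<sigma>)"
      by (intro emeasure_density) (auto simp: measurable_gaussian_cong sets_gaussian)
    also have "\<dots> = (\<integral>\<^sup>+z. (\<Prod>j<d. ennreal (exp ((\<mu> j * z j - (\<mu> j)\<^sup>2 / 2) / \<sigma>\<^sup>2)) * indicator (A j) (z j))
        \<partial>gaussian d (\<lambda>_. 0) \<sigma>)"
    proof (intro nn_integral_cong)
      \<comment> \<open>Membership in a \<open>Pi\<^sub>E\<close> box also demands extensionality;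
        the indicator therefore factors only for extensional \<open>z\<close>, which points of the
        space are.\<close>
      fix z assume "z \<in> space (gaussian d (\<lambda>_. 0) \<sigma>)"
      hence z: "z \<in> extensional {..<d}" by (auto simp: gaussian_def space_PiM PiE_def)
      have "indicator (Pi\<^sub>E {..<d} A) z = (\<Prod>j<d. indicator (A j) (z j) :: ennreal)"
        using z by (auto simp: indicator_def PiE_iff prod_zero_iff intro!: prod.neutral)
      thus "ennreal (gauss_lr d \<sigma> \<mu> z) * indicator (Pi\<^sub>E {..<d} A) z =
          (\<Prod>j<d. ennreal (exp ((\<mu> j * z j - (\<mu> j)\<^sup>2 / 2) / \<sigma>\<^sup>2)) * indicator (A j) (z j))"
        by (simp add: lr prod.distrib)
    qed
    also have "\<dots> = (\<Prod>j<d. \<integral>\<^sup>+z. ennreal (exp ((\<mu> j * z - (\<mu> j)\<^sup>2 / 2) / \<sigma>\<^sup>2)) * indicator (A j) z \<partial>normal 0 \<sigma>)"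
      unfolding gaussian_def by (rule Q.product_nn_integral_prod) (use A in auto)
    also have "\<dots> = (\<Prod>j<d. emeasure (normal (\<mu> j) \<sigma>) (A j))"
      using A by (intro prod.cong refl)
        (subst (2) normal_tilt[OF assms], subst emeasure_density, auto)
    finally show "emeasure ?D (Pi\<^sub>E {..<d} A) = (\<Prod>j\<in>{..<d}. emeasure (normal (\<mu> j) \<sigma>) (A j))" by simp
  qed simp
  thus ?thesis by (simp add: gaussian_def)
qed

lemma distr_gaussian_component:
  assumes "\<sigma> > 0" "j < d"
  shows "distr (gaussian d \<mu> \<sigma>) borel (\<lambda>z. z j) = normal (\<mu> j) \<sigma>"
proof -
  have "distr (gaussian d \<mu> \<sigma>) (normal (\<mu> j) \<sigma>) (\<lambda>z. z j) = normal (\<mu> j) \<sigma>"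
    unfolding gaussian_def
    by (rule distr_PiM_component) (use assms in \<open>auto intro: prob_space_normal_density\<close>)
  thus ?thesis by (subst distr_cong[OF refl _ refl]) auto
qed

text \<open>The only form of rotation invariance that is needed: an inner product with a unit vector
  is a sum of independent centred normals whose variances add up to
  \<open>\<sigma>\<^sup>2\<close>.\<close>

lemma distr_gaussian_inner:
  assumes \<sigma>: "\<sigma> > 0" and v: "(\<Sum>j<d. (v j)\<^sup>2) = 1"
  shows "distr (gaussian d (\<lambda>_. 0) \<sigma>) borel (\<lambda>z. \<Sum>j<d. v j * z j) = normal 0 \<sigma>"
proof -
  interpret prob_space "gaussian d (\<lambda>_. 0) \<sigma>" by (rule prob_space_gaussian[OF \<sigma>])
  \<comment> \<open>Coordinates with \<open>v j = 0\<close> are dropped, since scaling by 0 gives no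
    normal density; \<open>J\<close> is nonempty because the squares sum to 1.\<close>
  define J where "J = {j \<in> {..<d}. v j \<noteq> 0}"
  have v': "(\<Sum>j\<in>J. (v j)\<^sup>2) = 1"
    unfolding v[symmetric] J_def by (intro sum.mono_neutral_left) auto
  hence "J \<noteq> {}" by auto
  hence J: "finite J" "J \<noteq> {}" by (auto simp: J_def)
  have ne: "{..<d} \<noteq> {}" using J by (auto simp: J_def)
  have rv: "(\<lambda>z. z j) \<in> borel_measurable (gaussian d (\<lambda>_. 0) \<sigma>)" if "j < d" for j
    using that by (auto simp: measurable_gaussian_cong)
  have "indep_vars (\<lambda>_. borel) (\<lambda>j z. z j) {..<d}"
  proof (subst indep_vars_iff_distr_eq_PiM'[OF ne])
    \<comment> \<open>Independence is read off the joint law: the coordinate vector has the product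
      of its marginals as its distribution.\<close>
    have "distr (gaussian d (\<lambda>_. 0) \<sigma>) (euclid d) (\<lambda>z. \<lambda>j\<in>{..<d}. z j) = gaussian d (\<lambda>_. 0) \<sigma>"
      using gaussian_shift[OF \<sigma>, of d "\<lambda>_. 0"] by simp
    also have "\<dots> = PiM {..<d} (\<lambda>j. distr (gaussian d (\<lambda>_. 0) \<sigma>) borel (\<lambda>z. z j))"
      by (subst (1) gaussian_def, intro PiM_cong) (auto simp: distr_gaussian_component \<sigma>)
    finally show "distr (gaussian d (\<lambda>_. 0) \<sigma>) (euclid d) (\<lambda>z. \<lambda>j\<in>{..<d}. z j) =
        PiM {..<d} (\<lambda>j. distr (gaussian d (\<lambda>_. 0) \<sigma>) borel (\<lambda>z. z j))" .
  qed (auto simp: rv)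
  from indep_vars_compose2[OF this, of "\<lambda>j x. v j * x" "\<lambda>_. borel"]
  have "indep_vars (\<lambda>_. borel) (\<lambda>j z. v j * z j) {..<d}" by simp
  hence ind: "indep_vars (\<lambda>_. borel) (\<lambda>j z. v j * z j) J"
    by (rule indep_vars_subset) (auto simp: J_def)
  have "distributed (gaussian d (\<lambda>_. 0) \<sigma>) lborel (\<lambda>z. v j * z j) (normal_density 0 (\<bar>v j\<bar> * \<sigma>))"
    if "j \<in> J" for j
  proof -
    have j: "j < d" "v j \<noteq> 0" using that by (auto simp: J_def)
    have "distributed (gaussian d (\<lambda>_. 0) \<sigma>) lborel (\<lambda>z. z j) (normal_density 0 \<sigma>)"
      using distr_gaussian_component[OF \<sigma> j(1), of "\<lambda>_. 0"] rv[OF j(1)]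
      by (auto simp: distributed_def cong: distr_cong)
    from normal_density_affine[OF this \<sigma> j(2), of 0] show ?thesis by simp
  qed
  from sum_indep_normal[OF J ind _ this]
  have "distributed (gaussian d (\<lambda>_. 0) \<sigma>) lborel (\<lambda>z. \<Sum>j\<in>J. v j * z j)
      (normal_density (\<Sum>j\<in>J. 0) (sqrt (\<Sum>j\<in>J. (\<bar>v j\<bar> * \<sigma>)\<^sup>2)))"
    using \<sigma> by (auto simp: J_def)
  also have "(\<Sum>j\<in>J. (\<bar>v j\<bar> * \<sigma>)\<^sup>2) = \<sigma>\<^sup>2"
    using v' by (simp add: power_mult_distrib sum_distrib_right[symmetric])
  finally have "distr (gaussian d (\<lambda>_. 0) \<sigma>) lborel (\<lambda>z. \<Sum>j\<in>J. v j * z j) = normal 0 \<sigma>"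
    using \<sigma> by (simp add: distributed_def)
  moreover have "(\<Sum>j\<in>J. v j * z j) = (\<Sum>j<d. v j * z j)" for z
    unfolding J_def by (intro sum.mono_neutral_left) auto
  ultimately show ?thesis by (simp cong: distr_cong)
qed

section \<open>Averages of convex functions of likelihood ratios\<close>

text \<open>The class of integrands on which the backward induction runs. Convexity feeds Jensen's
  inequality, nonnegativity permits integrals in \<open>ennreal\<close>, and the Lipschitz bound
  yields measurability and integrability. The class contains the hinge functions and is stable under
  averaging over random translations.\<close>

definition cvx_lip :: "(real \<Rightarrow> real) \<Rightarrow> bool" where
  "cvx_lip F \<longleftrightarrow> convex_on UNIV F \<and> (\<forall>x. 0 \<le> F x) \<and> (\<forall>x y. \<bar>F x - F y\<bar> \<le> \<bar>x - y\<bar>)"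

lemma cvx_lip_hinge: "cvx_lip (\<lambda>a. max 0 (a - c))"
proof -
  have "convex_on UNIV (\<lambda>a::real. max 0 (a - c))"
  proof (intro convex_onI)
    fix t x y :: real assume t: "0 < t" "t < 1"
    have "(1 - t) *\<^sub>R x + t *\<^sub>R y - c = (1 - t) * (x - c) + t * (y - c)" by (simp add: algebra_simps)
    also have "\<dots> \<le> (1 - t) * max 0 (x - c) + t * max 0 (y - c)"
      using t by (intro add_mono mult_left_mono) auto
    finally show "max 0 ((1 - t) *\<^sub>R x + t *\<^sub>R y - c) \<le> (1 - t) * max 0 (x - c) + t * max 0 (y - c)"
      using t by auto
  qed simp
  thus ?thesis by (auto simp: cvx_lip_def)
qed

lemma cvx_lip_measurable: "cvx_lip F \<Longrightarrow> F \<in> borel_measurable borel"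
  by (rule borel_measurable_continuous_onI, rule lipschitz_on_continuous_on[where L = 1],
      rule lipschitz_onI) (auto simp: cvx_lip_def dist_real_def)

text \<open>The Lipschitz bound dominates the integrand by \<open>F a + \<bar>W x\<bar>\<close>,
  which is integrable; convexity, sign and Lipschitz constant then pass through the integral
  pointwise.\<close>

lemma cvx_lip_average:
  assumes "prob_space M" and W: "integrable M W" and F: "cvx_lip F"
  shows "integrable M (\<lambda>x. F (a + W x))"
    and "cvx_lip (\<lambda>a. \<integral>x. F (a + W x) \<partial>M)"
proof -
  interpret prob_space M by fact
  have [measurable]: "F \<in> borel_measurable borel" by (rule cvx_lip_measurable[OF F])
  have pos: "0 \<le> F x" and lip: "\<bar>F x - F y\<bar> \<le> \<bar>x - y\<bar>" for x y
    using F by (auto simp: cvx_lip_def)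
  show int: "integrable M (\<lambda>x. F (a + W x))" for a
  proof (rule Bochner_Integration.integrable_bound)
    show "integrable M (\<lambda>x. F a + \<bar>W x\<bar>)" using W by simp
    show "(\<lambda>x. F (a + W x)) \<in> borel_measurable M" using W by measurable
    show "AE x in M. norm (F (a + W x)) \<le> norm (F a + \<bar>W x\<bar>)"
    proof (intro AE_I2)
      fix x
      from lip[of "a + W x" a] pos[of a] pos[of "a + W x"]
      show "norm (F (a + W x)) \<le> norm (F a + \<bar>W x\<bar>)" by auto
    qed
  qed
  have "convex_on UNIV (\<lambda>a. \<integral>x. F (a + W x) \<partial>M)"
  proof (intro convex_onI)
    fix t a b :: real assume t: "0 < t" "t < 1"
    have "(\<integral>x. F ((1 - t) *\<^sub>R a + t *\<^sub>R b + W x) \<partial>M) \<le> (\<integral>x. (1 - t) * F (a + W x) + t * F (b + W x) \<partial>M)"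
    proof (intro integral_mono)
      fix x
      have "(1 - t) *\<^sub>R a + t *\<^sub>R b + W x = (1 - t) *\<^sub>R (a + W x) + t *\<^sub>R (b + W x)"
        by (simp add: algebra_simps)
      thus "F ((1 - t) *\<^sub>R a + t *\<^sub>R b + W x) \<le> (1 - t) * F (a + W x) + t * F (b + W x)"
        using F t convex_onD[of UNIV F t "a + W x" "b + W x"] by (simp only: cvx_lip_def) simp
    qed (use int in auto)
    thus "(\<integral>x. F ((1 - t) *\<^sub>R a + t *\<^sub>R b + W x) \<partial>M) \<le> (1 - t) * (\<integral>x. F (a + W x) \<partial>M) + t * (\<integral>x. F (b + W x) \<partial>M)"
      using int by simp
  qed simp
  moreover have "0 \<le> (\<integral>x. F (a + W x) \<partial>M)" for a by (simp add: pos)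
  moreover have "\<bar>(\<integral>x. F (a + W x) \<partial>M) - (\<integral>x. F (b + W x) \<partial>M)\<bar> \<le> \<bar>a - b\<bar>" for a b
  proof -
    have "\<bar>(\<integral>x. F (a + W x) \<partial>M) - (\<integral>x. F (b + W x) \<partial>M)\<bar> = \<bar>\<integral>x. F (a + W x) - F (b + W x) \<partial>M\<bar>"
      using int by simp
    also have "\<dots> \<le> (\<integral>x. \<bar>F (a + W x) - F (b + W x)\<bar> \<partial>M)" by (rule integral_abs_bound)
    also have "\<dots> \<le> (\<integral>x. \<bar>a - b\<bar> \<partial>M)"
      by (intro integral_mono integrable_abs Bochner_Integration.integrable_diff int)
         (use lip in \<open>auto intro: order_trans[OF lip]\<close>)
    finally show ?thesis by (simp add: prob_space)
  qed
  ultimately show "cvx_lip (\<lambda>a. \<integral>x. F (a + W x) \<partial>M)" by (auto simp: cvx_lip_def)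
qed

text \<open>The integrand is the density of a normal distribution with mean \<open>\<mu>\<close>
  relative to the centred one, so its integral is a total mass.\<close>

lemma normal_exp_moment:
  assumes "\<sigma> > 0"
  shows "(\<integral>\<^sup>+z. ennreal (exp ((\<mu> * z - \<mu>\<^sup>2 / 2) / \<sigma>\<^sup>2)) \<partial>normal 0 \<sigma>) = 1"
    and "integrable (normal 0 \<sigma>) (\<lambda>z. exp ((\<mu> * z - \<mu>\<^sup>2 / 2) / \<sigma>\<^sup>2))"
    and "(\<integral>z. exp ((\<mu> * z - \<mu>\<^sup>2 / 2) / \<sigma>\<^sup>2) \<partial>normal 0 \<sigma>) = 1"
proof -
  interpret prob_space "normal \<mu> \<sigma>" by (rule prob_space_normal_density[OF assms])
  have "emeasure (normal \<mu> \<sigma>) UNIV = 1" using emeasure_space_1 by simp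
  thus *: "(\<integral>\<^sup>+z. ennreal (exp ((\<mu> * z - \<mu>\<^sup>2 / 2) / \<sigma>\<^sup>2)) \<partial>normal 0 \<sigma>) = 1"
    by (subst (asm) normal_tilt[OF assms], subst (asm) emeasure_density) auto
  show "integrable (normal 0 \<sigma>) (\<lambda>z. exp ((\<mu> * z - \<mu>\<^sup>2 / 2) / \<sigma>\<^sup>2))"
    by (intro integrableI_nonneg) (auto simp: *)
  show "(\<integral>z. exp ((\<mu> * z - \<mu>\<^sup>2 / 2) / \<sigma>\<^sup>2) \<partial>normal 0 \<sigma>) = 1"
    by (subst integral_eq_nn_integral) (auto simp: *)
qed

text \<open>The value of \<open>gauss_lr\<close> for a unit vector \<open>u\<close> whose inner
  product with the noise is \<open>z\<close>.\<close>

definition bin_lr :: "real \<Rightarrow> real \<Rightarrow> real" where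
  "bin_lr \<sigma> z = exp ((z - 1 / 2) / \<sigma>\<^sup>2)"

text \<open>One backward step: \<open>a\<close> accumulates the weighted ratios of the batches not
  yet integrated out, and the current batch contributes its ratio with weight \<open>w\<close>.
  Iterating this operator produces the value function of the whole run.\<close>

definition avg_step :: "real \<Rightarrow> real \<Rightarrow> (real \<Rightarrow> real) \<Rightarrow> real \<Rightarrow> real" where
  "avg_step \<sigma> w F a = (\<integral>z. F (a + w * bin_lr \<sigma> z) \<partial>normal 0 \<sigma>)"

lemma bin_lr_measurable [measurable]: "bin_lr \<sigma> \<in> borel_measurable borel"
  unfolding bin_lr_def by measurable

lemma integrable_bin_lr: "\<sigma> > 0 \<Longrightarrow> integrable (normal 0 \<sigma>) (\<lambda>z. w * bin_lr \<sigma> z)"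
  using normal_exp_moment(2)[of \<sigma> 1] by (simp add: bin_lr_def)

lemma cvx_lip_avg_step:
  assumes "\<sigma> > 0" "cvx_lip F"
  shows "cvx_lip (avg_step \<sigma> w F)"
  unfolding avg_step_def
  by (rule cvx_lip_average(2)[OF prob_space_normal_density integrable_bin_lr]) (use assms in auto)

lemma avg_step_nn_integral:
  assumes "\<sigma> > 0" "cvx_lip F"
  shows "(\<integral>\<^sup>+z. ennreal (F (a + w * bin_lr \<sigma> z)) \<partial>normal 0 \<sigma>) = ennreal (avg_step \<sigma> w F a)"
  unfolding avg_step_def
proof (rule nn_integral_eq_integral)
  show "integrable (normal 0 \<sigma>) (\<lambda>z. F (a + w * bin_lr \<sigma> z))"
    by (rule cvx_lip_average(1)[OF prob_space_normal_density integrable_bin_lr]) (use assms in auto)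
qed (use assms in \<open>auto simp: cvx_lip_def\<close>)

text \<open>A query shorter than a unit vector is completed to a unit vector by an additional coordinate;
  averaging over the noise in that coordinate can only decrease convex functions.\<close>
lemma avg_step_gauss_lr:
  assumes \<sigma>: "\<sigma> > 0" and F: "cvx_lip F" and u: "(\<Sum>j<d. (u j)\<^sup>2) \<le> 1"
  shows "(\<integral>\<^sup>+\<xi>. ennreal (F (a + w * gauss_lr d \<sigma> u \<xi>)) \<partial>gaussian d (\<lambda>_. 0) \<sigma>) \<le> ennreal (avg_step \<sigma> w F a)"
proof -
  have Fm[measurable]: "F \<in> borel_measurable borel" by (rule cvx_lip_measurable[OF F])
  have Fpos: "0 \<le> F x" for x using F by (auto simp: cvx_lip_def)
  define s where "s = sqrt (1 - (\<Sum>j<d. (u j)\<^sup>2))"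
  define v where "v = u(d := s)"
  have s2: "s\<^sup>2 = 1 - (\<Sum>j<d. (u j)\<^sup>2)" using u by (simp add: s_def)
  have v: "(\<Sum>j<Suc d. (v j)\<^sup>2) = 1" by (simp add: v_def s2)
  interpret N: prob_space "normal 0 \<sigma>" by (rule prob_space_normal_density[OF \<sigma>])
  interpret Q: product_sigma_finite "\<lambda>j::nat. normal 0 \<sigma>" by standard
  have jensen: "ennreal (F (a + w * gauss_lr d \<sigma> u \<xi>)) \<le>
      (\<integral>\<^sup>+y. ennreal (F (a + w * bin_lr \<sigma> (\<Sum>j<Suc d. v j * (\<xi>(d := y)) j))) \<partial>normal 0 \<sigma>)" for \<xi>
  proof -
    \<comment> \<open>The ratio for the unit vector \<open>v\<close> is the ratio for
      \<open>u\<close> times that of the additional coordinate. The second factor has mean 1, so the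
      left side of \<open>jensen\<close> is \<open>F\<close> at the mean of the right side's
      argument.\<close>
    have eq: "bin_lr \<sigma> (\<Sum>j<Suc d. v j * (\<xi>(d := y)) j) = gauss_lr d \<sigma> u \<xi> * exp ((s * y - s\<^sup>2 / 2) / \<sigma>\<^sup>2)" for y
      by (simp add: bin_lr_def gauss_lr_def exp_add[symmetric] v_def s2 add_divide_distrib[symmetric])
         (simp add: field_simps)
    let ?W = "\<lambda>y. w * (gauss_lr d \<sigma> u \<xi> * exp ((s * y - s\<^sup>2 / 2) / \<sigma>\<^sup>2))"
    have W: "integrable (normal 0 \<sigma>) ?W"
      by (intro integrable_mult_right normal_exp_moment \<sigma>)
    have FW: "integrable (normal 0 \<sigma>) (\<lambda>y. F (a + ?W y))"
      by (rule cvx_lip_average(1)[OF N.prob_space_axioms W F])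
    have "F (a + w * gauss_lr d \<sigma> u \<xi>) = F (\<integral>y. a + ?W y \<partial>normal 0 \<sigma>)"
      using W by (subst Bochner_Integration.integral_add)
        (simp_all add: normal_exp_moment(3)[OF \<sigma>] N.prob_space[simplified])
    also have "\<dots> \<le> (\<integral>y. F (a + ?W y) \<partial>normal 0 \<sigma>)"
      by (rule N.jensens_inequality[where I = UNIV])
         (use W FW F in \<open>auto simp: cvx_lip_def\<close>)
    finally have "ennreal (F (a + w * gauss_lr d \<sigma> u \<xi>)) \<le> ennreal (\<integral>y. F (a + ?W y) \<partial>normal 0 \<sigma>)"
      by (rule ennreal_leI)
    also have "\<dots> = (\<integral>\<^sup>+y. ennreal (F (a + ?W y)) \<partial>normal 0 \<sigma>)"
      by (rule nn_integral_eq_integral[OF FW, symmetric]) (simp add: Fpos)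
    finally show ?thesis by (simp only: eq)
  qed
  have m: "(\<lambda>z. \<Sum>j<Suc d. v j * z j) \<in> borel_measurable (gaussian (Suc d) (\<lambda>_. 0) \<sigma>)"
    unfolding measurable_gaussian_cong by measurable
  have "(\<integral>\<^sup>+\<xi>. ennreal (F (a + w * gauss_lr d \<sigma> u \<xi>)) \<partial>gaussian d (\<lambda>_. 0) \<sigma>) \<le>
      (\<integral>\<^sup>+\<xi>. (\<integral>\<^sup>+y. ennreal (F (a + w * bin_lr \<sigma> (\<Sum>j<Suc d. v j * (\<xi>(d := y)) j))) \<partial>normal 0 \<sigma>)
        \<partial>gaussian d (\<lambda>_. 0) \<sigma>)"
    by (intro nn_integral_mono jensen)
  also have "\<dots> = (\<integral>\<^sup>+z. ennreal (F (a + w * bin_lr \<sigma> (\<Sum>j<Suc d. v j * z j))) \<partial>gaussian (Suc d) (\<lambda>_. 0) \<sigma>)"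
    using m unfolding gaussian_def lessThan_Suc
    by (intro Q.product_nn_integral_insert[symmetric]) auto
  also have "\<dots> = (\<integral>\<^sup>+y. ennreal (F (a + w * bin_lr \<sigma> y)) \<partial>normal 0 \<sigma>)"
    unfolding distr_gaussian_inner[OF \<sigma> v, symmetric] using m by (subst nn_integral_distr) auto
  also have "\<dots> = ennreal (avg_step \<sigma> w F a)" by (rule avg_step_nn_integral[OF \<sigma> F])
  finally show ?thesis .
qed

text \<open>Fubini, integrating the last coordinate first. This replaces \<open>F\<close> by
  \<open>avg_step \<sigma> w F\<close>, so the induction must be general in
  \<open>F\<close>.\<close>

lemma avg_step_iterate_bin_lr:
  assumes \<sigma>: "\<sigma> > 0" and F: "cvx_lip F"
  shows "(\<integral>\<^sup>+z. ennreal (F (a + (\<Sum>t<T. w * bin_lr \<sigma> (z t)))) \<partial>gaussian T (\<lambda>_. 0) \<sigma>) =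
    ennreal ((avg_step \<sigma> w ^^ T) F a)"
  using F
proof (induction T arbitrary: F)
  case 0
  show ?case by (simp add: gaussian_def nn_integral_count_space_finite PiM_empty)
next
  case (Suc T)
  interpret N: prob_space "normal 0 \<sigma>" by (rule prob_space_normal_density[OF \<sigma>])
  interpret Q: product_sigma_finite "\<lambda>j::nat. normal 0 \<sigma>" by standard
  have [measurable]: "F \<in> borel_measurable borel" by (rule cvx_lip_measurable[OF Suc.prems])
  have "(\<lambda>z. ennreal (F (a + (\<Sum>t<Suc T. w * bin_lr \<sigma> (z t))))) \<in>
      borel_measurable (gaussian (Suc T) (\<lambda>_. 0) \<sigma>)"
    unfolding measurable_gaussian_cong by measurable
  hence m: "(\<lambda>z. ennreal (F (a + (\<Sum>t<Suc T. w * bin_lr \<sigma> (z t))))) \<in>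
      borel_measurable (PiM (insert T {..<T}) (\<lambda>_. normal 0 \<sigma>))"
    by (simp only: gaussian_def lessThan_Suc)
  have "(\<integral>\<^sup>+z. ennreal (F (a + (\<Sum>t<Suc T. w * bin_lr \<sigma> (z t)))) \<partial>gaussian (Suc T) (\<lambda>_. 0) \<sigma>) =
      (\<integral>\<^sup>+z. \<integral>\<^sup>+y. ennreal (F (a + (\<Sum>t<Suc T. w * bin_lr \<sigma> ((z(T := y)) t)))) \<partial>normal 0 \<sigma> \<partial>gaussian T (\<lambda>_. 0) \<sigma>)"
    using Q.product_nn_integral_insert[OF _ _ m] by (simp add: lessThan_Suc gaussian_def)
  also have "\<dots> = (\<integral>\<^sup>+z. ennreal (avg_step \<sigma> w F (a + (\<Sum>t<T. w * bin_lr \<sigma> (z t)))) \<partial>gaussian T (\<lambda>_. 0) \<sigma>)"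
  proof (intro nn_integral_cong)
    fix z :: "nat \<Rightarrow> real"
    show "(\<integral>\<^sup>+y. ennreal (F (a + (\<Sum>t<Suc T. w * bin_lr \<sigma> ((z(T := y)) t)))) \<partial>normal 0 \<sigma>) =
        ennreal (avg_step \<sigma> w F (a + (\<Sum>t<T. w * bin_lr \<sigma> (z t))))"
      using avg_step_nn_integral[OF \<sigma> Suc.prems, of "a + (\<Sum>t<T. w * bin_lr \<sigma> (z t))" w]
      by (simp add: add.assoc)
  qed
  also have "\<dots> = ennreal ((avg_step \<sigma> w ^^ T) (avg_step \<sigma> w F) a)"
    by (rule Suc.IH[OF cvx_lip_avg_step[OF \<sigma> Suc.prems]])
  \<comment> \<open>The coordinate integrated first is the innermost application of the iterate,
    hence \<open>funpow_Suc_right\<close>.\<close>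
  finally show ?case by (simp only: funpow_Suc_right o_apply)
qed

section \<open>Adaptively chosen shifts, integrated out from the last batch to the first\<close>

abbreviation noise :: "nat \<Rightarrow> nat \<Rightarrow> real \<Rightarrow> (nat \<Rightarrow> nat \<Rightarrow> real) measure" where
  "noise T d \<sigma> \<equiv> PiM {..<T} (\<lambda>_. gaussian d (\<lambda>_. 0) \<sigma>)"

lemma measurable_PiM_gaussian_cong:
  "measurable (PiM I (\<lambda>_. gaussian d (\<lambda>_. 0) \<sigma>)) N = measurable (PiM I (\<lambda>_. euclid d)) N"
  by (intro measurable_cong_sets sets_PiM_cong) (auto simp: sets_gaussian)

lemma measurable_gauss_lr_comp:
  assumes u: "u \<in> M \<rightarrow>\<^sub>M euclid d" and z: "z \<in> M \<rightarrow>\<^sub>M euclid d"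
  shows "(\<lambda>x. gauss_lr d \<sigma> (u x) (z x)) \<in> borel_measurable M"
proof -
  have u': "(\<lambda>x. u x j) \<in> borel_measurable M" if "j < d" for j
    by (rule measurable_compose[OF u measurable_component_singleton]) (use that in auto)
  have z': "(\<lambda>x. z x j) \<in> borel_measurable M" if "j < d" for j
    by (rule measurable_compose[OF z measurable_component_singleton]) (use that in auto)
  have [measurable]: "(\<lambda>x. \<Sum>j<d. u x j * z x j) \<in> borel_measurable M"
    by (rule borel_measurable_sum, rule borel_measurable_times) (auto intro: u' z')
  have [measurable]: "(\<lambda>x. \<Sum>j<d. (u x j)\<^sup>2) \<in> borel_measurable M"
    by (rule borel_measurable_sum, rule borel_measurable_power) (auto intro: u')
  show ?thesis unfolding gauss_lr_def by measurable
qed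

text \<open>The same recursion as for \<open>bin_lr\<close>, with \<open>avg_step_gauss_lr\<close>
  in place of an equality at each step. Causality makes \<open>u T\<close> a constant vector while
  component \<open>T\<close> is integrated. Measurability is assumed on every product that is long
  enough, because the induction shortens the product.\<close>

lemma avg_step_iterate_gauss_lr:
  assumes \<sigma>: "\<sigma> > 0" and F: "cvx_lip F"
    and um: "\<And>t T'. t \<le> T' \<Longrightarrow> t < T \<Longrightarrow> u t \<in> PiM {..<T'} (\<lambda>_. euclid d) \<rightarrow>\<^sub>M euclid d"
    and causal: "\<And>t \<xi> \<xi>'. t < T \<Longrightarrow> (\<And>s. s < t \<Longrightarrow> \<xi> s = \<xi>' s) \<Longrightarrow> u t \<xi> = u t \<xi>'"
    and u1: "\<And>t \<xi>. t < T \<Longrightarrow> (\<Sum>j<d. (u t \<xi> j)\<^sup>2) \<le> 1"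
  shows "(\<integral>\<^sup>+\<xi>. ennreal (F (a + (\<Sum>t<T. w * gauss_lr d \<sigma> (u t \<xi>) (\<xi> t)))) \<partial>noise T d \<sigma>)
    \<le> ennreal ((avg_step \<sigma> w ^^ T) F a)"
  using F um causal u1
proof (induction T arbitrary: F)
  case 0
  show ?case by (simp add: nn_integral_count_space_finite PiM_empty)
next
  case (Suc T)
  interpret N: prob_space "gaussian d (\<lambda>_. 0) \<sigma>" by (rule prob_space_gaussian[OF \<sigma>])
  interpret Q: product_sigma_finite "\<lambda>j::nat. gaussian d (\<lambda>_. 0) \<sigma>" by standard
  note F = Suc.prems(1)
  have [measurable]: "F \<in> borel_measurable borel" by (rule cvx_lip_measurable[OF F])
  have lr: "(\<lambda>\<xi>. gauss_lr d \<sigma> (u t \<xi>) (\<xi> t)) \<in> borel_measurable (PiM {..<Suc T} (\<lambda>_. euclid d))"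
    if "t < Suc T" for t
    by (rule measurable_gauss_lr_comp, rule Suc.prems, use that in simp, use that in simp,
        rule measurable_component_singleton, use that in simp)
  have [measurable]: "(\<lambda>\<xi>. \<Sum>t<Suc T. w * gauss_lr d \<sigma> (u t \<xi>) (\<xi> t)) \<in>
      borel_measurable (PiM {..<Suc T} (\<lambda>_. euclid d))"
    by (rule borel_measurable_sum, rule borel_measurable_times) (auto intro: lr)
  have "(\<lambda>\<xi>. ennreal (F (a + (\<Sum>t<Suc T. w * gauss_lr d \<sigma> (u t \<xi>) (\<xi> t))))) \<in>
      borel_measurable (PiM {..<Suc T} (\<lambda>_. euclid d))"
    by measurable
  hence m: "(\<lambda>\<xi>. ennreal (F (a + (\<Sum>t<Suc T. w * gauss_lr d \<sigma> (u t \<xi>) (\<xi> t))))) \<in>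
      borel_measurable (PiM (insert T {..<T}) (\<lambda>_. gaussian d (\<lambda>_. 0) \<sigma>))"
    by (simp only: measurable_PiM_gaussian_cong lessThan_Suc)
  have "(\<integral>\<^sup>+\<xi>. ennreal (F (a + (\<Sum>t<Suc T. w * gauss_lr d \<sigma> (u t \<xi>) (\<xi> t)))) \<partial>noise (Suc T) d \<sigma>) =
      (\<integral>\<^sup>+\<xi>. \<integral>\<^sup>+y. ennreal (F (a + (\<Sum>t<Suc T. w * gauss_lr d \<sigma> (u t (\<xi>(T := y))) ((\<xi>(T := y)) t))))
        \<partial>gaussian d (\<lambda>_. 0) \<sigma> \<partial>noise T d \<sigma>)"
    using Q.product_nn_integral_insert[OF _ _ m] by (simp add: lessThan_Suc)
  also have "\<dots> = (\<integral>\<^sup>+\<xi>. \<integral>\<^sup>+y. ennreal (F ((a + (\<Sum>t<T. w * gauss_lr d \<sigma> (u t \<xi>) (\<xi> t))) +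
        w * gauss_lr d \<sigma> (u T \<xi>) y)) \<partial>gaussian d (\<lambda>_. 0) \<sigma> \<partial>noise T d \<sigma>)"
  proof (intro nn_integral_cong)
    fix \<xi> y
    \<comment> \<open>The update touches component \<open>T\<close> only, and every
      \<open>u t\<close> with \<open>t \<le> T\<close> depends on strictly earlier
      components.\<close>
    have "u t (\<xi>(T := y)) = u t \<xi>" if "t < Suc T" for t
      by (rule Suc.prems(3)) (use that in auto)
    thus "ennreal (F (a + (\<Sum>t<Suc T. w * gauss_lr d \<sigma> (u t (\<xi>(T := y))) ((\<xi>(T := y)) t)))) =
        ennreal (F ((a + (\<Sum>t<T. w * gauss_lr d \<sigma> (u t \<xi>) (\<xi> t))) + w * gauss_lr d \<sigma> (u T \<xi>) y))"
      by (simp add: add.assoc)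
  qed
  also have "\<dots> \<le> (\<integral>\<^sup>+\<xi>. ennreal (avg_step \<sigma> w F (a + (\<Sum>t<T. w * gauss_lr d \<sigma> (u t \<xi>) (\<xi> t)))) \<partial>noise T d \<sigma>)"
    by (intro nn_integral_mono avg_step_gauss_lr \<sigma> F Suc.prems) auto
  also have "\<dots> \<le> ennreal ((avg_step \<sigma> w ^^ T) (avg_step \<sigma> w F) a)"
  proof (rule Suc.IH[OF cvx_lip_avg_step[OF \<sigma> F]])
    show "u t \<in> PiM {..<T'} (\<lambda>_. euclid d) \<rightarrow>\<^sub>M euclid d" if "t \<le> T'" "t < T" for t T'
      by (rule Suc.prems(2)) (use that in simp_all)
    show "u t \<xi> = u t \<xi>'" if "t < T" "\<And>s. s < t \<Longrightarrow> \<xi> s = \<xi>' s" for t \<xi> \<xi>'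
      by (rule Suc.prems(3)) (use that in simp_all)
    show "(\<Sum>j<d. (u t \<xi> j)\<^sup>2) \<le> 1" if "t < T" for t \<xi>
      by (rule Suc.prems(4)) (use that in simp)
  qed
  finally show ?case by (simp only: funpow_Suc_right o_apply)
qed

section \<open>Shifting the noise of one batch\<close>

text \<open>Both sides integrate \<open>g\<close> against the Gaussian centred at
  \<open>\<mu>\<close>, described once as a push-forward and once by its density.\<close>

lemma nn_integral_gaussian_shift:
  assumes \<sigma>: "\<sigma> > 0" and g: "g \<in> borel_measurable (euclid d)"
  shows "(\<integral>\<^sup>+z. g (\<lambda>j\<in>{..<d}. z j + \<mu> j) \<partial>gaussian d (\<lambda>_. 0) \<sigma>) =
    (\<integral>\<^sup>+z. ennreal (gauss_lr d \<sigma> \<mu> z) * g z \<partial>gaussian d (\<lambda>_. 0) \<sigma>)"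
proof -
  have "(\<lambda>z. \<lambda>j\<in>{..<d}. z j + \<mu> j) \<in> gaussian d (\<lambda>_. 0) \<sigma> \<rightarrow>\<^sub>M euclid d"
    unfolding measurable_gaussian_cong by (rule measurable_restrict) measurable
  hence "(\<integral>\<^sup>+z. g (\<lambda>j\<in>{..<d}. z j + \<mu> j) \<partial>gaussian d (\<lambda>_. 0) \<sigma>) = (\<integral>\<^sup>+z. g z \<partial>gaussian d \<mu> \<sigma>)"
    unfolding gaussian_shift[OF \<sigma>, of d \<mu>, symmetric] using g by (subst nn_integral_distr) auto
  also have "\<dots> = (\<integral>\<^sup>+z. ennreal (gauss_lr d \<sigma> \<mu> z) * g z \<partial>gaussian d (\<lambda>_. 0) \<sigma>)"
    unfolding gaussian_tilt[OF \<sigma>, of d \<mu>]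
    using g by (intro nn_integral_density) (auto simp: measurable_gaussian_cong)
  finally show ?thesis .
qed

text \<open>The shift is computed from the unshifted noise. For a causal \<open>u\<close>, which
  sees only components before \<open>s\<close>, shifting component \<open>s\<close> does not alter
  it.\<close>

definition shift_noise ::
    "nat \<Rightarrow> ((nat \<Rightarrow> nat \<Rightarrow> real) \<Rightarrow> nat \<Rightarrow> real) \<Rightarrow> nat \<Rightarrow> (nat \<Rightarrow> nat \<Rightarrow> real) \<Rightarrow> nat \<Rightarrow> nat \<Rightarrow> real" where
  "shift_noise d u s \<xi> = \<xi>(s := \<lambda>j\<in>{..<d}. \<xi> s j + u \<xi> j)"

lemma measurable_shift_noise:
  assumes s: "s < T" and u: "u \<in> PiM {..<T} (\<lambda>_. euclid d) \<rightarrow>\<^sub>M euclid d"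
  shows "shift_noise d u s \<in> PiM {..<T} (\<lambda>_. euclid d) \<rightarrow>\<^sub>M PiM {..<T} (\<lambda>_. euclid d)"
proof -
  have u': "(\<lambda>\<xi>. u \<xi> j) \<in> borel_measurable (PiM {..<T} (\<lambda>_. euclid d))" if "j < d" for j
    by (rule measurable_compose[OF u measurable_component_singleton]) (use that in auto)
  have z': "(\<lambda>\<xi>. \<xi> s j) \<in> borel_measurable (PiM {..<T} (\<lambda>_. euclid d))" if "j < d" for j
    by (rule measurable_compose[where f = "\<lambda>\<xi>. \<xi> s" and g = "\<lambda>v. v j" and N = "euclid d"];
        rule measurable_component_singleton) (use that s in auto)
  show ?thesis unfolding shift_noise_def
  proof (rule measurable_fun_upd[where J = "{..<T}"])
    show "(\<lambda>\<xi>. \<lambda>j\<in>{..<d}. \<xi> s j + u \<xi> j) \<in> PiM {..<T} (\<lambda>_. euclid d) \<rightarrow>\<^sub>M euclid d"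
      by (rule measurable_restrict, rule borel_measurable_add) (auto intro: u' z')
  qed (use s in auto)
qed

text \<open>With all components except \<open>s\<close> frozen, causality makes the shift a fixed
  vector, and \<open>nn_integral_gaussian_shift\<close> applies to the inner integral.\<close>

lemma nn_integral_shift_noise:
  assumes \<sigma>: "\<sigma> > 0" and s: "s < T"
    and f: "f \<in> borel_measurable (PiM {..<T} (\<lambda>_. euclid d))"
    and u: "u \<in> PiM {..<T} (\<lambda>_. euclid d) \<rightarrow>\<^sub>M euclid d"
    and causal: "\<And>\<xi> \<xi>'. (\<And>r. r < s \<Longrightarrow> \<xi> r = \<xi>' r) \<Longrightarrow> u \<xi> = u \<xi>'"
  shows "(\<integral>\<^sup>+\<xi>. f (shift_noise d u s \<xi>) \<partial>noise T d \<sigma>) =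
    (\<integral>\<^sup>+\<xi>. ennreal (gauss_lr d \<sigma> (u \<xi>) (\<xi> s)) * f \<xi> \<partial>noise T d \<sigma>)"
proof -
  interpret N: prob_space "gaussian d (\<lambda>_. 0) \<sigma>" by (rule prob_space_gaussian[OF \<sigma>])
  interpret Q: product_sigma_finite "\<lambda>j::nat. gaussian d (\<lambda>_. 0) \<sigma>" by standard
  \<comment> \<open>Component \<open>s\<close> is made the innermost integral whatever its position:
    \<open>f\<close> may also depend on the components after \<open>s\<close>, and these stay frozen
    too.\<close>
  let ?I = "{..<T} - {s}"
  have I: "finite ?I" "s \<notin> ?I" "insert s ?I = {..<T}" using s by auto
  note fold = Q.product_nn_integral_insert[OF I(1,2), unfolded I(3)]
  have m1: "(\<lambda>\<xi>. f (shift_noise d u s \<xi>)) \<in> borel_measurable (noise T d \<sigma>)"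
    unfolding measurable_PiM_gaussian_cong
    by (rule measurable_compose[OF measurable_shift_noise[OF s u] f])
  have "(\<lambda>\<xi>. gauss_lr d \<sigma> (u \<xi>) (\<xi> s)) \<in> borel_measurable (PiM {..<T} (\<lambda>_. euclid d))"
    by (rule measurable_gauss_lr_comp[OF u], rule measurable_component_singleton) (use s in auto)
  hence m2: "(\<lambda>\<xi>. ennreal (gauss_lr d \<sigma> (u \<xi>) (\<xi> s)) * f \<xi>) \<in> borel_measurable (noise T d \<sigma>)"
    unfolding measurable_PiM_gaussian_cong using f by measurable
  show ?thesis unfolding fold[OF m1] fold[OF m2]
  proof (rule nn_integral_cong)
    fix \<xi> assume "\<xi> \<in> space (PiM ?I (\<lambda>_. gaussian d (\<lambda>_. 0) \<sigma>))"
    hence \<xi>: "\<xi> \<in> space (PiM ?I (\<lambda>_. euclid d))"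
      by (simp add: space_PiM gaussian_def)
    have "(\<lambda>y. \<xi>(s := y)) \<in> euclid d \<rightarrow>\<^sub>M PiM {..<T} (\<lambda>_. euclid d)"
      using measurable_component_update[OF \<xi> I(2)] unfolding I(3) .
    hence g: "(\<lambda>y. f (\<xi>(s := y))) \<in> borel_measurable (euclid d)"
      by (rule measurable_compose[OF _ f])
    have u_eq: "u (\<xi>(s := y)) = u \<xi>" for y by (rule causal) auto
    show "(\<integral>\<^sup>+y. f (shift_noise d u s (\<xi>(s := y))) \<partial>gaussian d (\<lambda>_. 0) \<sigma>) =
        (\<integral>\<^sup>+y. ennreal (gauss_lr d \<sigma> (u (\<xi>(s := y))) ((\<xi>(s := y)) s)) * f (\<xi>(s := y)) \<partial>gaussian d (\<lambda>_. 0) \<sigma>)"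
      using nn_integral_gaussian_shift[OF \<sigma> g, of "u \<xi>"] by (simp add: shift_noise_def u_eq)
  qed
qed

section \<open>The mechanism for fixed bins\<close>

definition bins :: "nat \<Rightarrow> nat \<Rightarrow> (nat \<Rightarrow> nat) \<Rightarrow> nat set list" where
  "bins T n b = map (\<lambda>t. {k. k < n \<and> b k = t}) [0..<T]"

lemma nth_bins: "t < T \<Longrightarrow> bins T n b ! t = {k. k < n \<and> b k = t}"
  by (simp add: bins_def)

lemma ablq_answers_causal:
  "(\<And>s. s < t \<Longrightarrow> \<xi> s = \<xi>' s) \<Longrightarrow> ablq_answers d A x S \<xi> t = ablq_answers d A x S \<xi>' t"
  by (induction t) (simp_all add: Let_def)

text \<open>No condition on \<open>\<xi>\<close> is required, because every answer is restricted to
  \<open>{..<d}\<close>. Hence the norm bound on queries holds for all \<open>\<xi>\<close>, as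
  \<open>avg_step_iterate_gauss_lr\<close> asks.\<close>

lemma ablq_answers_in_space: "ablq_answers d A x S \<xi> t \<in> lists (space (euclid d))"
  by (induction t) (auto simp: Let_def space_PiM)

text \<open>A record equal to \<open>None\<close> contributes the zero vector to whichever batch
  receives it.\<close>

lemma ablq_answers_irrelevant_bin:
  assumes i: "x ! i = None" and b: "\<And>k. k \<noteq> i \<Longrightarrow> b k = b' k" and "t \<le> T"
  shows "ablq_answers d A x (bins T (length x) b) \<xi> t = ablq_answers d A x (bins T (length x) b') \<xi> t"
  using \<open>t \<le> T\<close>
proof (induction t)
  case (Suc t)
  have *: "(\<Sum>k\<in>bins T (length x) b ! t \<inter> {..<length x}. extend_query d A gs (x ! k) j) =
      (\<Sum>k\<in>bins T (length x) b' ! t \<inter> {..<length x}. extend_query d A gs (x ! k) j)"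
    if "j < d" for gs j
  proof -
    define g where "g k = extend_query d A gs (x ! k) j" for k
    have "g i = 0" using i that by (simp add: g_def extend_query_def)
    hence "(\<Sum>k\<in>bins T (length x) b0 ! t \<inter> {..<length x}. g k) =
        (\<Sum>k\<in>{k. k < length x \<and> k \<noteq> i \<and> b0 k = t}. g k)" for b0
      using Suc.prems by (intro sum.mono_neutral_right) (auto simp: nth_bins)
    moreover have "{k. k < length x \<and> k \<noteq> i \<and> b k = t} = {k. k < length x \<and> k \<noteq> i \<and> b' k = t}"
      using b by auto
    ultimately show ?thesis by (simp add: g_def)
  qed
  have IH: "ablq_answers d A x (bins T (length x) b) \<xi> t = ablq_answers d A x (bins T (length x) b') \<xi> t"
    using Suc by simp
  show ?case unfolding ablq_answers.simps Let_def IH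
    using * by (auto intro!: restrict_ext)
qed simp

text \<open>The coupling behind the upper bound. Outside batch \<open>s\<close> both runs add the
  same vectors; in batch \<open>s\<close> the contribution of the differing record is absorbed into
  the noise. Equal answers so far give equal queries, so the runs never separate.\<close>

lemma ablq_answers_shift:
  assumes len: "length x' = length x" and i: "i < length x" "x ! i = Some y" "x' ! i = None"
    and eq: "\<And>j. j < length x \<Longrightarrow> j \<noteq> i \<Longrightarrow> x ! j = x' ! j"
    and b: "b i = s" and t: "t \<le> T"
    and u: "\<And>\<xi>. u \<xi> = A (ablq_answers d A x' (bins T (length x) b) \<xi> s) y"
  shows "ablq_answers d A x (bins T (length x) b) \<xi> t =
    ablq_answers d A x' (bins T (length x) b) (shift_noise d u s \<xi>) t"
  using t
proof (induction t)
  case (Suc t)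
  let ?gs = "ablq_answers d A x' (bins T (length x) b) (shift_noise d u s \<xi>) t"
  let ?S = "bins T (length x) b ! t \<inter> {..<length x}"
  have S: "?S = {k. k < length x \<and> b k = t}" using Suc.prems by (auto simp: nth_bins)
  have "(\<Sum>k\<in>?S. extend_query d A ?gs (x ! k) j) + \<xi> t j =
      (\<Sum>k\<in>?S. extend_query d A ?gs (x' ! k) j) + shift_noise d u s \<xi> t j" if j: "j < d" for j
  proof (cases "t = s")
    case False
    have "x ! k = x' ! k" if "k \<in> ?S" for k
      using that False b by (intro eq) (auto simp: S)
    hence "(\<Sum>k\<in>?S. extend_query d A ?gs (x ! k) j) = (\<Sum>k\<in>?S. extend_query d A ?gs (x' ! k) j)"
      by simp
    thus ?thesis using False by (simp add: shift_noise_def)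
  next
    case True
    have iS: "finite ?S" "i \<in> ?S" using True b i Suc.prems by (auto simp: nth_bins)
    have "(\<Sum>k\<in>?S - {i}. extend_query d A ?gs (x ! k) j) = (\<Sum>k\<in>?S - {i}. extend_query d A ?gs (x' ! k) j)"
      by (intro sum.cong) (auto simp: S eq)
    \<comment> \<open>The history before batch \<open>s\<close> does not see the shifted component,
      so \<open>u\<close> may be defined from the unshifted noise.\<close>
    moreover have "?gs = ablq_answers d A x' (bins T (length x) b) \<xi> s"
      unfolding True by (rule ablq_answers_causal) (simp add: shift_noise_def)
    hence "extend_query d A ?gs (x ! i) j = u \<xi> j" by (simp add: i u extend_query_def)
    moreover have "extend_query d A ?gs (x' ! i) j = 0" using j by (simp add: i extend_query_def)
    moreover have "shift_noise d u s \<xi> t j = \<xi> t j + u \<xi> j" using j True by (simp add: shift_noise_def)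
    ultimately show ?thesis
      using sum.remove[OF iS, of "\<lambda>k. extend_query d A ?gs (x ! k) j"]
        sum.remove[OF iS, of "\<lambda>k. extend_query d A ?gs (x' ! k) j"] by linarith
  qed
  note * = this
  have IH: "ablq_answers d A x (bins T (length x) b) \<xi> t = ?gs" using Suc by simp
  show ?case unfolding ablq_answers.simps Let_def IH len
    using * by (auto intro!: restrict_ext)
qed simp

section \<open>Distribution of the output for fixed bins and its divergence bound\<close>

definition ablq_output ::
    "nat \<Rightarrow> nat \<Rightarrow> ((nat \<Rightarrow> real) list \<Rightarrow> 'x \<Rightarrow> nat \<Rightarrow> real) \<Rightarrow> 'x option list \<Rightarrow> nat set list \<Rightarrow>
     (nat \<Rightarrow> nat \<Rightarrow> real) \<Rightarrow> nat \<Rightarrow> nat \<Rightarrow> real" where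
  "ablq_output T d A x S \<xi> = (\<lambda>t\<in>{..<T}. ablq_answers d A x S \<xi> T ! t)"

definition ablq_given ::
    "nat \<Rightarrow> real \<Rightarrow> nat \<Rightarrow> ((nat \<Rightarrow> real) list \<Rightarrow> 'x \<Rightarrow> nat \<Rightarrow> real) \<Rightarrow> 'x option list \<Rightarrow> nat set list \<Rightarrow>
     (nat \<Rightarrow> nat \<Rightarrow> real) measure" where
  "ablq_given T \<sigma> d A x S =
     distr (noise T d \<sigma>) (PiM {..<T} (\<lambda>_. euclid d)) (ablq_output T d A x S)"

lemma measurable_ablq_output:
  assumes A: "adaptive_query_method d X A" and x: "x \<in> datasets X n"
  shows "ablq_output T d A x S \<in> PiM {..<T} (\<lambda>_. euclid d) \<rightarrow>\<^sub>M PiM {..<T} (\<lambda>_. euclid d)"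
  unfolding ablq_output_def
  by (rule measurable_restrict, subst nth_ablq_answers, simp, rule measurable_ablq_answers[OF A x]) simp

lemma prob_space_ablq_given:
  assumes "\<sigma> > 0" "adaptive_query_method d X A" "x \<in> datasets X n"
  shows "prob_space (ablq_given T \<sigma> d A x S)"
  unfolding ablq_given_def
  by (rule prob_space.prob_space_distr)
     (auto intro!: prob_space_PiM prob_space_gaussian measurable_ablq_output assms
       simp: measurable_PiM_gaussian_cong)

text \<open>Measurability of the query method is stated for tuples of each length, so the history, a
  list, is rewritten as the list of a measurable tuple.\<close>

lemma measurable_query:
  assumes A: "adaptive_query_method d X A" and x: "x \<in> datasets X n" and y: "y \<in> X" and t: "t \<le> T"
  shows "(\<lambda>\<xi>. A (ablq_answers d A x S \<xi> t) y) \<in> PiM {..<T} (\<lambda>_. euclid d) \<rightarrow>\<^sub>M euclid d"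
proof -
  have eq: "ablq_answers d A x S \<xi> t = map (\<lambda>s\<in>{..<t}. ablq_answers d A x S \<xi> (Suc s) ! s) [0..<t]" for \<xi>
    by (intro nth_equalityI)
       (auto simp: length_ablq_answers simp del: ablq_answers.simps intro: nth_ablq_answers)
  have "(\<lambda>\<xi>. \<lambda>s\<in>{..<t}. ablq_answers d A x S \<xi> (Suc s) ! s) \<in>
      PiM {..<T} (\<lambda>_. euclid d) \<rightarrow>\<^sub>M PiM {..<t} (\<lambda>_. euclid d)"
    by (rule measurable_restrict, rule measurable_ablq_answers[OF A x]) (use t in auto)
  moreover have "(\<lambda>g. A (map g [0..<t]) y) \<in> PiM {..<t} (\<lambda>_. euclid d) \<rightarrow>\<^sub>M euclid d"
    using A y by (auto simp: adaptive_query_method_def)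
  ultimately have "(\<lambda>\<xi>. A (map (\<lambda>s\<in>{..<t}. ablq_answers d A x S \<xi> (Suc s) ! s) [0..<t]) y) \<in>
      PiM {..<T} (\<lambda>_. euclid d) \<rightarrow>\<^sub>M euclid d"
    by (rule measurable_compose)
  thus ?thesis by (simp only: eq[symmetric])
qed

text \<open>The hockey stick divergence of \<open>P_bb\<close> from \<open>Q_bb\<close>, with the coordinates integrated out one at a time.\<close>
definition bb_hockey :: "nat \<Rightarrow> real \<Rightarrow> real \<Rightarrow> real" where
  "bb_hockey T \<sigma> c = (avg_step \<sigma> (1 / real T) ^^ T) (\<lambda>a. max 0 (a - c)) 0"

lemma bb_hockey_nonneg:
  assumes "\<sigma> > 0"
  shows "0 \<le> bb_hockey T \<sigma> c"
proof -
  have "cvx_lip ((avg_step \<sigma> w ^^ k) (\<lambda>a. max 0 (a - c)))" for k w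
    by (induction k) (auto intro: cvx_lip_hinge cvx_lip_avg_step assms)
  thus ?thesis by (auto simp: bb_hockey_def cvx_lip_def)
qed

text \<open>After the change of measure every term is an integral over one noise space and one
  event, with indicator \<open>I\<close>. Since \<open>I\<close> is 0 or 1,
  \<open>L * I \<le> max 0 (L - c) + c * I\<close> for the weighted sum \<open>L\<close> of the
  ratios, and the expectation of the hinge is bounded by
  \<open>avg_step_iterate_gauss_lr\<close>.\<close>

lemma ablq_given_hockey:
  assumes \<sigma>: "\<sigma> > 0" and A: "adaptive_query_method d X A"
    and x: "x \<in> datasets X n" and x': "x' \<in> datasets X n"
    and len: "length x' = length x" and i: "i < length x" "x ! i = Some y" "x' ! i = None" and y: "y \<in> X"
    and eq: "\<And>j. j < length x \<Longrightarrow> j \<noteq> i \<Longrightarrow> x ! j = x' ! j"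
    and c: "c \<ge> 0" and \<Gamma>: "\<Gamma> \<in> sets (PiM {..<T} (\<lambda>_. euclid d))"
  shows "(\<Sum>s<T. 1 / real T * measure (ablq_given T \<sigma> d A x (bins T (length x) (b(i := s)))) \<Gamma>)
    - c * measure (ablq_given T \<sigma> d A x' (bins T (length x) b)) \<Gamma> \<le> bb_hockey T \<sigma> c"
proof -
  define S where "S = bins T (length x) b"
  define u where "u = (\<lambda>s \<xi>. A (ablq_answers d A x' S \<xi> s) y)"
  define w where "w = 1 / real T"
  define I where "I = (\<lambda>\<xi>. indicator \<Gamma> (ablq_output T d A x' S \<xi>) :: ennreal)"
  define L where "L = (\<lambda>s \<xi>. gauss_lr d \<sigma> (u s \<xi>) (\<xi> s))"
  let ?E = "PiM {..<T} (\<lambda>_. euclid d)"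
  have w: "w \<ge> 0" by (simp add: w_def)
  interpret G: prob_space "ablq_given T \<sigma> d A x S'" for S' by (rule prob_space_ablq_given[OF \<sigma> A x])
  interpret G': prob_space "ablq_given T \<sigma> d A x' S'" for S' by (rule prob_space_ablq_given[OF \<sigma> A x'])
  have causal: "u s \<xi> = u s \<xi>'" if "\<And>r. r < s \<Longrightarrow> \<xi> r = \<xi>' r" for s \<xi> \<xi>'
    unfolding u_def by (subst ablq_answers_causal[of s \<xi> \<xi>', OF that]) simp_all
  have um: "u s \<in> PiM {..<T'} (\<lambda>_. euclid d) \<rightarrow>\<^sub>M euclid d" if "s \<le> T'" for s T'
    unfolding u_def by (rule measurable_query[OF A x' y that])
  have u1: "(\<Sum>j<d. (u s \<xi> j)\<^sup>2) \<le> 1" for s \<xi>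
  proof -
    have "ablq_answers d A x' S \<xi> s \<in> lists (space (euclid d))" by (rule ablq_answers_in_space)
    hence "u s \<xi> \<in> unit_ball d"
      unfolding u_def using A y by (simp only: adaptive_query_method_def)
    thus ?thesis by (simp add: unit_ball_def L2_set_def)
  qed
  have Im: "I \<in> borel_measurable ?E"
    unfolding I_def using measurable_compose[OF measurable_ablq_output[OF A x'] borel_measurable_indicator[OF \<Gamma>]] .
  have Lm: "L s \<in> borel_measurable ?E" if "s < T" for s
    unfolding L_def
    by (rule measurable_gauss_lr_comp[OF um measurable_component_singleton]) (use that in auto)
  have emeasure_G: "emeasure (ablq_given T \<sigma> d A x0 S0) \<Gamma> =
      (\<integral>\<^sup>+\<xi>. indicator \<Gamma> (ablq_output T d A x0 S0 \<xi>) \<partial>noise T d \<sigma>)" if "x0 \<in> datasets X n" for x0 S0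
  proof -
    have m: "ablq_output T d A x0 S0 \<in> noise T d \<sigma> \<rightarrow>\<^sub>M ?E"
      unfolding measurable_PiM_gaussian_cong by (rule measurable_ablq_output[OF A that])
    have "emeasure (ablq_given T \<sigma> d A x0 S0) \<Gamma> = (\<integral>\<^sup>+g. indicator \<Gamma> g \<partial>ablq_given T \<sigma> d A x0 S0)"
      using \<Gamma> by (simp add: ablq_given_def)
    also have "\<dots> = (\<integral>\<^sup>+\<xi>. indicator \<Gamma> (ablq_output T d A x0 S0 \<xi>) \<partial>noise T d \<sigma>)"
      unfolding ablq_given_def using \<Gamma> by (intro nn_integral_distr[OF m]) auto
    finally show ?thesis .
  qed
  have p: "emeasure (ablq_given T \<sigma> d A x (bins T (length x) (b(i := s)))) \<Gamma> =
      (\<integral>\<^sup>+\<xi>. ennreal (L s \<xi>) * I \<xi> \<partial>noise T d \<sigma>)" if s: "s < T" for s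
  proof -
    \<comment> \<open>Record \<open>i\<close> is \<open>None\<close> in \<open>x'\<close>, so all
      \<open>T\<close> placements of it are compared with one and the same run on
      \<open>S\<close>.\<close>
    have *: "ablq_answers d A x' (bins T (length x) (b(i := s))) \<xi> t = ablq_answers d A x' S \<xi> t"
      if "t \<le> T" for \<xi> t
      using ablq_answers_irrelevant_bin[where x = x', OF i(3), of "b(i := s)" b t T] that len by (simp add: S_def)
    have "ablq_answers d A x (bins T (length x) (b(i := s))) \<xi> T =
        ablq_answers d A x' (bins T (length x) (b(i := s))) (shift_noise d (u s) s \<xi>) T" for \<xi>
      by (rule ablq_answers_shift[OF len i eq]) (use * s in \<open>auto simp: u_def\<close>)
    hence "ablq_output T d A x (bins T (length x) (b(i := s))) \<xi> =
        ablq_output T d A x' S (shift_noise d (u s) s \<xi>)" for \<xi>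
      by (simp add: ablq_output_def *)
    hence "emeasure (ablq_given T \<sigma> d A x (bins T (length x) (b(i := s)))) \<Gamma> =
        (\<integral>\<^sup>+\<xi>. I (shift_noise d (u s) s \<xi>) \<partial>noise T d \<sigma>)"
      by (simp add: emeasure_G[OF x] I_def)
    also have "\<dots> = (\<integral>\<^sup>+\<xi>. ennreal (L s \<xi>) * I \<xi> \<partial>noise T d \<sigma>)"
      unfolding L_def by (rule nn_integral_shift_noise[OF \<sigma> s Im um causal]) (use s in auto)
    finally show ?thesis .
  qed
  have m: "(\<lambda>\<xi>. ennreal (L s \<xi>) * I \<xi>) \<in> borel_measurable (noise T d \<sigma>)"
    "(\<lambda>\<xi>. L s \<xi>) \<in> borel_measurable (noise T d \<sigma>)" if "s < T" for s
    unfolding measurable_PiM_gaussian_cong using Im Lm[OF that] by measurable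
  have mI: "I \<in> borel_measurable (noise T d \<sigma>)"
    unfolding measurable_PiM_gaussian_cong by (rule Im)
  have mS: "(\<lambda>\<xi>. \<Sum>s<T. w * L s \<xi>) \<in> borel_measurable (noise T d \<sigma>)"
    by (rule borel_measurable_sum, rule borel_measurable_times) (auto intro: m)
  \<comment> \<open>The comparison takes place in \<open>ennreal\<close>, so the subtracted term is
    kept on the right as \<open>ennreal c * I\<close>. The \<open>0 +\<close> inside the hinge is
    the initial value of the accumulator \<open>a\<close>.\<close>
  have "ennreal (\<Sum>s<T. w * measure (ablq_given T \<sigma> d A x (bins T (length x) (b(i := s)))) \<Gamma>) =
      (\<Sum>s<T. ennreal w * emeasure (ablq_given T \<sigma> d A x (bins T (length x) (b(i := s)))) \<Gamma>)"
    using w by (subst sum_ennreal[symmetric]) (auto simp: G.emeasure_eq_measure ennreal_mult)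
  also have "\<dots> = (\<Sum>s<T. \<integral>\<^sup>+\<xi>. ennreal w * (ennreal (L s \<xi>) * I \<xi>) \<partial>noise T d \<sigma>)"
    by (intro sum.cong refl) (simp add: p nn_integral_cmult m)
  also have "\<dots> = (\<integral>\<^sup>+\<xi>. (\<Sum>s<T. ennreal w * (ennreal (L s \<xi>) * I \<xi>)) \<partial>noise T d \<sigma>)"
    by (rule nn_integral_sum[symmetric]) (auto intro!: borel_measurable_times_ennreal m)
  also have "\<dots> \<le> (\<integral>\<^sup>+\<xi>. ennreal (max 0 (0 + (\<Sum>s<T. w * L s \<xi>) - c)) + ennreal c * I \<xi> \<partial>noise T d \<sigma>)"
  proof (rule nn_integral_mono)
    fix \<xi>
    have L0: "L s \<xi> \<ge> 0" for s by (simp add: L_def gauss_lr_def)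
    have "(\<Sum>s<T. ennreal w * (ennreal (L s \<xi>) * I \<xi>)) = ennreal (\<Sum>s<T. w * L s \<xi>) * I \<xi>"
      using w L0 by (simp add: sum_ennreal[symmetric] sum_distrib_right ennreal_mult mult.assoc)
    also have "\<dots> \<le> ennreal (max 0 (0 + (\<Sum>s<T. w * L s \<xi>) - c)) + ennreal c * I \<xi>"
    proof -
      have "(\<Sum>s<T. w * L s \<xi>) \<le> max 0 (0 + (\<Sum>s<T. w * L s \<xi>) - c) + c" by simp
      hence "ennreal (\<Sum>s<T. w * L s \<xi>) \<le> ennreal (max 0 (0 + (\<Sum>s<T. w * L s \<xi>) - c) + c)"
        by (rule ennreal_leI)
      also have "\<dots> = ennreal (max 0 (0 + (\<Sum>s<T. w * L s \<xi>) - c)) + ennreal c"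
        using c by (intro ennreal_plus) auto
      finally show ?thesis unfolding I_def
        by (cases "ablq_output T d A x' S \<xi> \<in> \<Gamma>") (simp_all del: ennreal_plus)
    qed
    finally show "(\<Sum>s<T. ennreal w * (ennreal (L s \<xi>) * I \<xi>)) \<le>
        ennreal (max 0 (0 + (\<Sum>s<T. w * L s \<xi>) - c)) + ennreal c * I \<xi>" .
  qed
  also have "\<dots> = (\<integral>\<^sup>+\<xi>. ennreal (max 0 (0 + (\<Sum>s<T. w * L s \<xi>) - c)) \<partial>noise T d \<sigma>) +
      ennreal c * (\<integral>\<^sup>+\<xi>. I \<xi> \<partial>noise T d \<sigma>)"
    using mS mI by (subst nn_integral_add) (auto simp: nn_integral_cmult)
  also have "\<dots> \<le> ennreal (bb_hockey T \<sigma> c) + ennreal c * emeasure (ablq_given T \<sigma> d A x' S) \<Gamma>"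
  proof (rule add_mono)
    show "(\<integral>\<^sup>+\<xi>. ennreal (max 0 (0 + (\<Sum>s<T. w * L s \<xi>) - c)) \<partial>noise T d \<sigma>) \<le> ennreal (bb_hockey T \<sigma> c)"
      unfolding L_def bb_hockey_def w_def[symmetric]
      by (rule avg_step_iterate_gauss_lr[OF \<sigma> cvx_lip_hinge um causal u1])
  qed (simp add: emeasure_G[OF x'] I_def)
  also have "\<dots> = ennreal (bb_hockey T \<sigma> c + c * measure (ablq_given T \<sigma> d A x' S) \<Gamma>)"
    using c bb_hockey_nonneg[OF \<sigma>] by (simp add: G'.emeasure_eq_measure ennreal_mult)
  finally have "(\<Sum>s<T. w * measure (ablq_given T \<sigma> d A x (bins T (length x) (b(i := s)))) \<Gamma>) \<le>
      bb_hockey T \<sigma> c + c * measure (ablq_given T \<sigma> d A x' S) \<Gamma>"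
    using c bb_hockey_nonneg[OF \<sigma>] by (subst (asm) ennreal_le_iff) auto
  thus ?thesis by (simp add: w_def S_def)
qed

section \<open>Domination\<close>

text \<open>Conditioning on the bins of all other records: the bin of record \<open>i\<close> is
  independent of them and uniform, which yields the inner average over \<open>s\<close>.\<close>

lemma measure_ablq_balls_and_bins:
  assumes \<sigma>: "\<sigma> > 0" and T: "T \<ge> 1" and A: "adaptive_query_method d X A" and x: "x \<in> datasets X n"
    and i: "i < length x" and \<Gamma>: "\<Gamma> \<in> sets (PiM {..<T} (\<lambda>_. euclid d))"
  shows "measure (ablq (balls_and_bins T) T \<sigma> d A x) \<Gamma> =
    measure_pmf.expectation (Pi_pmf ({..<length x} - {i}) 0 (\<lambda>_. pmf_of_set {..<T}))
      (\<lambda>b. \<Sum>s<T. 1 / real T * measure (ablq_given T \<sigma> d A x (bins T (length x) (b(i := s)))) \<Gamma>)"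
proof -
  let ?p = "pmf_of_set {..<T}"
  let ?P = "Pi_pmf ({..<length x} - {i}) 0 (\<lambda>_. ?p)"
  let ?h = "\<lambda>b. measure (ablq_given T \<sigma> d A x (bins T (length x) b)) \<Gamma>"
  interpret G: prob_space "ablq_given T \<sigma> d A x S" for S by (rule prob_space_ablq_given[OF \<sigma> A x])
  have ne: "{..<T} \<noteq> {}" using T by (auto simp: lessThan_empty_iff)
  \<comment> \<open>Finite support makes every function integrable, so sums and expectations can be
    exchanged freely.\<close>
  have fin: "finite (set_pmf ?P)"
  proof (rule finite_subset[OF set_Pi_pmf_subset'])
    show "finite (PiE_dflt ({..<length x} - {i}) 0 (set_pmf \<circ> (\<lambda>_. ?p)))"
      by (rule finite_PiE_dflt) (use ne in auto)
  qed simp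
  have ablq: "ablq (balls_and_bins T) T \<sigma> d A x = measure_pmf (balls_and_bins T (length x)) \<bind> ablq_given T \<sigma> d A x"
    unfolding ablq_def ablq_given_def[abs_def] ablq_output_def[abs_def] ..
  have K: "ablq_given T \<sigma> d A x \<in>
      measurable (measure_pmf (balls_and_bins T (length x))) (subprob_algebra (PiM {..<T} (\<lambda>_. euclid d)))"
    using G.subprob_space_axioms by (auto simp: space_subprob_algebra ablq_given_def)
  have "measure (ablq (balls_and_bins T) T \<sigma> d A x) \<Gamma> =
      measure_pmf.expectation (balls_and_bins T (length x)) (\<lambda>S. measure (ablq_given T \<sigma> d A x S) \<Gamma>)"
    unfolding ablq by (rule subprob_space.measure_bind[OF _ K \<Gamma>]) (rule measure_pmf.subprob_space_axioms)
  also have "\<dots> = measure_pmf.expectation (Pi_pmf {..<length x} 0 (\<lambda>_. ?p)) ?h"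
    by (simp add: balls_and_bins_def bins_def)
  also have "{..<length x} = insert i ({..<length x} - {i})" using i by auto
  also have "Pi_pmf \<dots> 0 (\<lambda>_. ?p) = ?p \<bind> (\<lambda>s. map_pmf (\<lambda>b. b(i := s)) ?P)"
    by (subst Pi_pmf_insert') (auto simp: map_pmf_def)
  also have "measure_pmf.expectation \<dots> ?h =
      (\<Sum>s<T. pmf ?p s *\<^sub>R measure_pmf.expectation (map_pmf (\<lambda>b. b(i := s)) ?P) ?h)"
    by (rule pmf_expectation_bind) (use ne fin in auto)
  also have "\<dots> = (\<Sum>s<T. measure_pmf.expectation ?P (\<lambda>b. 1 / real T * ?h (b(i := s))))"
    using ne by (intro sum.cong refl) simp
  also have "\<dots> = measure_pmf.expectation ?P (\<lambda>b. \<Sum>s<T. 1 / real T * ?h (b(i := s)))"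
    by (rule Bochner_Integration.integral_sum[symmetric]) (intro integrable_measure_pmf_finite fin)
  finally show ?thesis .
qed

text \<open>For a fixed event, the difference is an average over the other records' bins of
  differences that \<open>ablq_given_hockey\<close> bounds uniformly.\<close>

lemma ablq_hockey_stick_le:
  assumes \<sigma>: "\<sigma> > 0" and T: "T \<ge> 1" and A: "adaptive_query_method d X A"
    and x: "x \<in> datasets X n" and x': "x' \<in> datasets X n" and adj: "zeroing_adjacent X x x'" and c: "c \<ge> 0"
  shows "hockey_stick c (ablq (balls_and_bins T) T \<sigma> d A x) (ablq (balls_and_bins T) T \<sigma> d A x')
    \<le> bb_hockey T \<sigma> c"
  unfolding hockey_stick_def
proof (rule cSUP_least)
  fix \<Gamma> assume "\<Gamma> \<in> sets (ablq (balls_and_bins T) T \<sigma> d A x)"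
  hence \<Gamma>: "\<Gamma> \<in> sets (PiM {..<T} (\<lambda>_. euclid d))" using ablq_prob_space(2)[OF \<sigma> A x] by simp
  obtain i y where len: "length x' = length x" and i: "i < length x" "x ! i = Some y" "x' ! i = None"
    and y: "y \<in> X" and eq: "\<And>j. j < length x \<Longrightarrow> j \<noteq> i \<Longrightarrow> x ! j = x' ! j"
    using adj unfolding zeroing_adjacent_def by auto
  let ?P = "Pi_pmf ({..<length x} - {i}) 0 (\<lambda>_. pmf_of_set {..<T})"
  let ?p = "\<lambda>b. \<Sum>s<T. 1 / real T * measure (ablq_given T \<sigma> d A x (bins T (length x) (b(i := s)))) \<Gamma>"
  let ?q = "\<lambda>b. measure (ablq_given T \<sigma> d A x' (bins T (length x) b)) \<Gamma>"
  have fin: "finite (set_pmf ?P)"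
  proof (rule finite_subset[OF set_Pi_pmf_subset'])
    show "finite (PiE_dflt ({..<length x} - {i}) 0 (set_pmf \<circ> (\<lambda>_. pmf_of_set {..<T})))"
      by (rule finite_PiE_dflt) (use T in \<open>auto simp: lessThan_empty_iff\<close>)
  qed simp
  \<comment> \<open>On \<open>x'\<close> the average over the bin of record \<open>i\<close> is an
    average of equal terms and collapses to a single run.\<close>
  have "ablq_output T d A x' (bins T (length x) (b(i := s))) = ablq_output T d A x' (bins T (length x) b)" for b s
    using ablq_answers_irrelevant_bin[where x = x', OF i(3), of "b(i := s)" b T T] len
    by (simp add: ablq_output_def fun_eq_iff)
  hence q: "(\<Sum>s<T. 1 / real T * measure (ablq_given T \<sigma> d A x' (bins T (length x) (b(i := s)))) \<Gamma>) = ?q b" for b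
    using T by (simp add: ablq_given_def)
  have "measure (ablq (balls_and_bins T) T \<sigma> d A x') \<Gamma> = measure_pmf.expectation ?P ?q"
    using measure_ablq_balls_and_bins[OF \<sigma> T A x' _ \<Gamma>, of i] i(1) len by (simp only: q)
  moreover have "measure (ablq (balls_and_bins T) T \<sigma> d A x) \<Gamma> = measure_pmf.expectation ?P ?p"
    by (rule measure_ablq_balls_and_bins[OF \<sigma> T A x i(1) \<Gamma>])
  ultimately have "measure (ablq (balls_and_bins T) T \<sigma> d A x) \<Gamma> - c * measure (ablq (balls_and_bins T) T \<sigma> d A x') \<Gamma>
      = measure_pmf.expectation ?P (\<lambda>b. ?p b - c * ?q b)"
    by (simp add: integrable_measure_pmf_finite fin)
  also have "\<dots> \<le> measure_pmf.expectation ?P (\<lambda>b. bb_hockey T \<sigma> c)"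
    by (intro integral_mono integrable_measure_pmf_finite fin ablq_given_hockey[OF \<sigma> A x x' len i y eq c \<Gamma>])
  finally show "measure (ablq (balls_and_bins T) T \<sigma> d A x) \<Gamma> - c * measure (ablq (balls_and_bins T) T \<sigma> d A x') \<Gamma>
      \<le> bb_hockey T \<sigma> c" by simp
qed auto

section \<open>The bound is attained by \<open>P_bb\<close> and \<open>Q_bb\<close>\<close>

lemma prob_space_P_bb:
  assumes "\<sigma> > 0" "T \<ge> 1"
  shows "prob_space (P_bb T \<sigma>)" "sets (P_bb T \<sigma>) = sets (euclid T)"
proof -
  interpret p: prob_space "gaussian T (std_basis t) \<sigma>" for t by (rule prob_space_gaussian[OF assms(1)])
  have K: "(\<lambda>t. gaussian T (std_basis t) \<sigma>) \<in> measurable (measure_pmf (pmf_of_set {..<T})) (subprob_algebra (euclid T))"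
    by (auto simp: space_subprob_algebra sets_gaussian p.subprob_space_axioms intro!: measurable_measure_pmf)
  show "prob_space (P_bb T \<sigma>)" unfolding P_bb_def
    by (rule measure_pmf.prob_space_bind[OF _ K]) (simp add: p.prob_space_axioms)
  show "sets (P_bb T \<sigma>) = sets (euclid T)" unfolding P_bb_def
    by (rule sets_bind) (auto simp: sets_gaussian)
qed

text \<open>A supremum of reals bounds its members only if the family is bounded above; here 1 is a
  bound because \<open>c \<ge> 0\<close>.\<close>

lemma hockey_stick_upper:
  assumes "prob_space P" "c \<ge> 0" "\<Gamma> \<in> sets P"
  shows "measure P \<Gamma> - c * measure Q \<Gamma> \<le> hockey_stick c P Q"
  unfolding hockey_stick_def
proof (rule cSUP_upper[OF assms(3)], rule bdd_aboveI2)
  interpret prob_space P by fact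
  fix \<Delta>
  have "measure P \<Delta> \<le> 1" "0 \<le> c * measure Q \<Delta>" using assms(2) by auto
  thus "measure P \<Delta> - c * measure Q \<Delta> \<le> 1" by linarith
qed

text \<open>The Neyman-Pearson event, where the density of \<open>P_bb\<close> relative to
  \<open>Q_bb\<close> exceeds \<open>c\<close>, realizes the expectation of the hinge, which
  \<open>avg_step_iterate_bin_lr\<close> identifies with \<open>bb_hockey\<close>.\<close>

lemma bb_hockey_le:
  assumes \<sigma>: "\<sigma> > 0" and T: "T \<ge> 1" and c: "c \<ge> 0"
  shows "bb_hockey T \<sigma> c \<le> hockey_stick c (P_bb T \<sigma>) (Q_bb T \<sigma>)"
proof -
  interpret Q: prob_space "Q_bb T \<sigma>" unfolding Q_bb_def by (rule prob_space_gaussian[OF \<sigma>])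
  interpret N: prob_space "gaussian T \<mu> \<sigma>" for \<mu> by (rule prob_space_gaussian[OF \<sigma>])
  define w where "w = 1 / real T"
  have w: "w \<ge> 0" by (simp add: w_def)
  \<comment> \<open>This is that density: by \<open>lr\<close> below, the component centred at the
    \<open>t\<close>-th basis vector has ratio \<open>bin_lr \<sigma> (z t)\<close>.\<close>
  define L where "L z = (\<Sum>t<T. w * bin_lr \<sigma> (z t))" for z :: "nat \<Rightarrow> real"
  have Lm[measurable]: "L \<in> borel_measurable (euclid T)"
    unfolding L_def[abs_def] by measurable
  define E where "E = {z \<in> space (euclid T). L z > c}"
  have E: "E \<in> sets (euclid T)" unfolding E_def by measurable
  have Lm': "L \<in> borel_measurable (Q_bb T \<sigma>)" unfolding Q_bb_def measurable_gaussian_cong by (rule Lm)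
  have E': "E \<in> sets (Q_bb T \<sigma>)" using E by (simp add: Q_bb_def sets_gaussian)
  have bm: "(\<lambda>z. bin_lr \<sigma> (z t)) \<in> borel_measurable (Q_bb T \<sigma>)" if "t < T" for t
    unfolding Q_bb_def measurable_gaussian_cong
    by (rule measurable_compose[where f = "\<lambda>z. z t" and g = "bin_lr \<sigma>" and N = borel];
        use that in \<open>auto intro: measurable_component_singleton bin_lr_measurable\<close>)
  have lr: "gauss_lr T \<sigma> (std_basis t) z = bin_lr \<sigma> (z t)" if "t < T" for t z
    using that by (simp add: gauss_lr_def bin_lr_def std_basis_def if_distrib[of "\<lambda>x. x ^ 2"]
        if_distrib[of "\<lambda>x. x * _"] cong: if_cong)
  have "ennreal (bb_hockey T \<sigma> c + c * measure (Q_bb T \<sigma>) E) =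
      (\<integral>\<^sup>+z. ennreal (max 0 (0 + L z - c)) \<partial>Q_bb T \<sigma>) + ennreal c * emeasure (Q_bb T \<sigma>) E"
    using c avg_step_iterate_bin_lr[OF \<sigma> cvx_lip_hinge, of T 0 w c] bb_hockey_nonneg[OF \<sigma>]
    by (simp add: Q_bb_def bb_hockey_def w_def L_def N.emeasure_eq_measure ennreal_mult)
  also have "\<dots> = (\<integral>\<^sup>+z. ennreal (max 0 (0 + L z - c)) + ennreal c * indicator E z \<partial>Q_bb T \<sigma>)"
    using Lm' E' by (subst nn_integral_add) (auto simp: nn_integral_cmult)
  \<comment> \<open>Pointwise, \<open>max 0 (L z - c)\<close> plus \<open>c\<close> on
    \<open>E\<close> equals \<open>L z\<close> on \<open>E\<close> and 0 elsewhere.\<close>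
  also have "\<dots> = (\<integral>\<^sup>+z. (\<Sum>t<T. ennreal w * (ennreal (bin_lr \<sigma> (z t)) * indicator E z)) \<partial>Q_bb T \<sigma>)"
  proof (rule nn_integral_cong)
    fix z assume "z \<in> space (Q_bb T \<sigma>)"
    hence z: "z \<in> space (euclid T)" by (simp add: Q_bb_def gaussian_def space_PiM)
    have "(\<Sum>t<T. ennreal w * (ennreal (bin_lr \<sigma> (z t)) * indicator E z)) = ennreal (L z) * indicator E z"
      using w by (simp add: L_def sum_ennreal[symmetric] sum_distrib_right ennreal_mult mult.assoc bin_lr_def)
    also have "\<dots> = ennreal (max 0 (0 + L z - c)) + ennreal c * indicator E z"
    proof (cases "z \<in> E")
      case True
      hence "L z > c" by (simp add: E_def)
      hence "ennreal (max 0 (0 + L z - c)) + ennreal c = ennreal (max 0 (0 + L z - c) + c)"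
        using c by (intro ennreal_plus[symmetric]) auto
      thus ?thesis using True \<open>L z > c\<close> by simp
    next
      case False
      hence "L z \<le> c" using z by (simp add: E_def)
      thus ?thesis using False by (simp add: max_absorb1)
    qed
    finally show "ennreal (max 0 (0 + L z - c)) + ennreal c * indicator E z =
        (\<Sum>t<T. ennreal w * (ennreal (bin_lr \<sigma> (z t)) * indicator E z))" ..
  qed
  also have "\<dots> = (\<Sum>t<T. \<integral>\<^sup>+z. ennreal w * (ennreal (bin_lr \<sigma> (z t)) * indicator E z) \<partial>Q_bb T \<sigma>)"
    using E' bm by (intro nn_integral_sum) auto
  also have "\<dots> = (\<Sum>t<T. ennreal w * emeasure (gaussian T (std_basis t) \<sigma>) E)"
  proof (rule sum.cong[OF refl])
    fix t assume "t \<in> {..<T}"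
    hence t: "t < T" by simp
    have "emeasure (gaussian T (std_basis t) \<sigma>) E =
        (\<integral>\<^sup>+z. ennreal (gauss_lr T \<sigma> (std_basis t) z) * indicator E z \<partial>Q_bb T \<sigma>)"
      unfolding gaussian_tilt[OF \<sigma>, of T "std_basis t"] Q_bb_def
      by (rule emeasure_density) (auto simp: measurable_gaussian_cong sets_gaussian E)
    thus "(\<integral>\<^sup>+z. ennreal w * (ennreal (bin_lr \<sigma> (z t)) * indicator E z) \<partial>Q_bb T \<sigma>) =
        ennreal w * emeasure (gaussian T (std_basis t) \<sigma>) E"
      using bm[OF t] E' by (simp add: lr[OF t] nn_integral_cmult)
  qed
  also have "\<dots> = ennreal (\<Sum>t<T. w * measure (gaussian T (std_basis t) \<sigma>) E)"
    using w by (subst sum_ennreal[symmetric]) (auto simp: N.emeasure_eq_measure ennreal_mult)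
  also have "(\<Sum>t<T. w * measure (gaussian T (std_basis t) \<sigma>) E) = measure (P_bb T \<sigma>) E"
    unfolding measure_P_bb[OF \<sigma> T E] w_def ..
  finally have "bb_hockey T \<sigma> c + c * measure (Q_bb T \<sigma>) E = measure (P_bb T \<sigma>) E"
    using c bb_hockey_nonneg[OF \<sigma>] by (subst (asm) ennreal_inj) auto
  moreover have "measure (P_bb T \<sigma>) E - c * measure (Q_bb T \<sigma>) E \<le> hockey_stick c (P_bb T \<sigma>) (Q_bb T \<sigma>)"
    by (rule hockey_stick_upper[OF prob_space_P_bb(1)[OF \<sigma> T] c]) (simp add: prob_space_P_bb(2)[OF \<sigma> T] E)
  ultimately show ?thesis by linarith
qed

section \<open>Tightness\<close>

definition unit_query :: "(nat \<Rightarrow> real) list \<Rightarrow> 'x \<Rightarrow> nat \<Rightarrow> real" where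
  "unit_query gs r = (\<lambda>j\<in>{..<1}. 1)"

lemma adaptive_query_method_unit_query: "adaptive_query_method 1 X unit_query"
proof -
  have u: "(\<lambda>j\<in>{..<1}. 1) \<in> space (euclid 1)" by (simp add: space_PiM)
  hence "(\<lambda>j\<in>{..<1}. 1) \<in> unit_ball 1" by (simp add: unit_ball_def L2_set_def)
  thus ?thesis using u by (simp add: adaptive_query_method_def unit_query_def)
qed

text \<open>The mean of answer \<open>t\<close> under \<open>unit_query\<close>; as a vector indexed
  by \<open>t\<close> it is the centre of the output distribution.\<close>

definition queried :: "'x option list \<Rightarrow> nat set list \<Rightarrow> nat \<Rightarrow> real" where
  "queried x S t = (\<Sum>k\<in>S ! t \<inter> {..<length x}. if x ! k = None then 0 else 1)"

lemma unit_query_answers: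
  "t < T \<Longrightarrow> ablq_answers 1 unit_query x S \<xi> T ! t = (\<lambda>j\<in>{..<1}. queried x S t + \<xi> t j)"
proof -
  assume "t < T"
  hence "ablq_answers 1 unit_query x S \<xi> T ! t = ablq_answers 1 unit_query x S \<xi> (Suc t) ! t"
    by (rule nth_ablq_answers)
  also have "\<dots> = (\<lambda>j\<in>{..<1}. queried x S t + \<xi> t j)"
    unfolding ablq_answers.simps Let_def nth_append length_ablq_answers queried_def
    by (simp, intro restrict_ext arg_cong2[where f = "(+)"] sum.cong)
       (auto simp: extend_query_def unit_query_def split: option.splits)
  finally show ?thesis .
qed

text \<open>Identifies sequences of one-dimensional answers with vectors indexed by the batches, the
  space of \<open>P_bb\<close> and \<open>Q_bb\<close>.\<close>

definition flatten :: "nat \<Rightarrow> (nat \<Rightarrow> nat \<Rightarrow> real) \<Rightarrow> nat \<Rightarrow> real" where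
  "flatten T g = (\<lambda>t\<in>{..<T}. g t 0)"

lemma measurable_flatten: "flatten T \<in> PiM {..<T} (\<lambda>_. euclid 1) \<rightarrow>\<^sub>M euclid T"
  unfolding flatten_def
  by (rule measurable_restrict,
      rule measurable_compose[where f = "\<lambda>\<xi>. \<xi> _" and g = "\<lambda>v. v 0" and N = "euclid 1"];
      rule measurable_component_singleton) auto

text \<open>Constant queries ignore the history, so for fixed batches the output is the noise
  translated by a fixed vector.\<close>

lemma distr_flatten_unit_query:
  assumes \<sigma>: "\<sigma> > 0" and x: "x \<in> datasets X n"
  shows "distr (ablq_given T \<sigma> 1 unit_query x S) (euclid T) (flatten T) = gaussian T (queried x S) \<sigma>"
proof -
  have out: "ablq_output T 1 unit_query x S \<in> noise T 1 \<sigma> \<rightarrow>\<^sub>M PiM {..<T} (\<lambda>_. euclid 1)"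
    unfolding measurable_PiM_gaussian_cong
    by (rule measurable_ablq_output[OF adaptive_query_method_unit_query x])
  have "distr (ablq_given T \<sigma> 1 unit_query x S) (euclid T) (flatten T) =
      distr (noise T 1 \<sigma>) (euclid T) (flatten T \<circ> ablq_output T 1 unit_query x S)"
    unfolding ablq_given_def by (rule distr_distr[OF measurable_flatten out])
  also have "flatten T \<circ> ablq_output T 1 unit_query x S = (\<lambda>\<xi>. \<lambda>t\<in>{..<T}. \<xi> t 0 + queried x S t)"
    by (auto simp: flatten_def ablq_output_def unit_query_answers[simplified] fun_eq_iff)
  also have "distr (noise T 1 \<sigma>) (euclid T) \<dots> =
      PiM {..<T} (\<lambda>t. distr (gaussian 1 (\<lambda>_. 0) \<sigma>) borel (\<lambda>v. v 0 + queried x S t))"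
    by (rule distr_PiM_coordinatewise)
       (auto intro!: prob_space_gaussian \<sigma> borel_measurable_add measurable_component_singleton
         simp: measurable_gaussian_cong simp del: One_nat_def)
  also have "\<dots> = gaussian T (queried x S) \<sigma>"
    unfolding gaussian_def[of T]
  proof (rule PiM_cong[OF refl])
    fix t
    have m: "(\<lambda>v. v 0) \<in> borel_measurable (gaussian 1 (\<lambda>_. 0) \<sigma>)"
      unfolding measurable_gaussian_cong by (rule measurable_component_singleton) simp
    have "distr (gaussian 1 (\<lambda>_. 0) \<sigma>) borel (\<lambda>v. v 0 + queried x S t) =
        distr (distr (gaussian 1 (\<lambda>_. 0) \<sigma>) borel (\<lambda>v. v 0)) borel (\<lambda>z. z + queried x S t)"
      using m by (subst distr_distr) (auto simp: comp_def)
    also have "\<dots> = normal (queried x S t) \<sigma>"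
      using distr_gaussian_component[OF \<sigma>, of 0 1 "\<lambda>_. 0"] distr_normal_affine[OF \<sigma>, of 1 "queried x S t"]
      by simp
    finally show "distr (gaussian 1 (\<lambda>_. 0) \<sigma>) borel (\<lambda>v. v 0 + queried x S t) = normal (queried x S t) \<sigma>" .
  qed
  finally show ?thesis .
qed

lemma gaussian_cong: "(\<And>j. j < d \<Longrightarrow> \<mu> j = \<nu> j) \<Longrightarrow> gaussian d \<mu> \<sigma> = gaussian d \<nu> \<sigma>"
  unfolding gaussian_def by (rule PiM_cong) auto

text \<open>Each event for the pair is pulled back along \<open>flatten\<close> to an event of the
  same probabilities for the mechanism. The bins of the \<open>None\<close> records have no
  influence, so the expectation over them is that of a constant.\<close>

lemma ablq_hockey_stick_ge:
  fixes y :: 'x and x x' :: "'x option list"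
  assumes \<sigma>: "\<sigma> > 0" and T: "T \<ge> 1" and c: "c \<ge> 0"
    and x: "x = Some y # replicate m None" and x': "x' = None # replicate m None"
  shows "hockey_stick c (P_bb T \<sigma>) (Q_bb T \<sigma>) \<le>
    hockey_stick c (ablq (balls_and_bins T) T \<sigma> 1 unit_query x) (ablq (balls_and_bins T) T \<sigma> 1 unit_query x')"
  unfolding hockey_stick_def[of c "P_bb T \<sigma>"]
proof (rule cSUP_least)
  fix \<Gamma> assume "\<Gamma> \<in> sets (P_bb T \<sigma>)"
  hence \<Gamma>: "\<Gamma> \<in> sets (euclid T)" by (simp add: prob_space_P_bb[OF \<sigma> T])
  define \<Delta> where "\<Delta> = flatten T -` \<Gamma> \<inter> space (PiM {..<T} (\<lambda>_. euclid 1))"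
  have \<Delta>: "\<Delta> \<in> sets (PiM {..<T} (\<lambda>_. euclid 1))"
    unfolding \<Delta>_def by (rule measurable_sets[OF measurable_flatten \<Gamma>])
  have xd: "x \<in> datasets UNIV (Suc m)" "x' \<in> datasets UNIV (Suc m)" by (auto simp: x x' datasets_def)
  have given: "measure (ablq_given T \<sigma> 1 unit_query z S) \<Delta> = measure (gaussian T (queried z S) \<sigma>) \<Gamma>"
    if "z \<in> datasets UNIV (Suc m)" for z :: "'x option list" and S
  proof -
    have m: "flatten T \<in> ablq_given T \<sigma> 1 unit_query z S \<rightarrow>\<^sub>M euclid T"
      using measurable_flatten by (simp add: ablq_given_def)
    have "measure (gaussian T (queried z S) \<sigma>) \<Gamma> =
        measure (ablq_given T \<sigma> 1 unit_query z S) (flatten T -` \<Gamma> \<inter> space (ablq_given T \<sigma> 1 unit_query z S))"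
      unfolding distr_flatten_unit_query[OF \<sigma> that, symmetric] by (rule measure_distr[OF m \<Gamma>])
    thus ?thesis by (simp add: \<Delta>_def ablq_given_def)
  qed
  have len: "length x = Suc m" "length x' = Suc m" by (simp_all add: x x')
  have qx: "queried x (bins T (length x) (b(0 := s))) t = std_basis s t" if "t < T" for b s t
  proof -
    have *: "x ! k = None \<longleftrightarrow> k \<noteq> 0" if "k < Suc m" for k
      using that by (cases k) (auto simp: x)
    \<comment> \<open>Only record 0 counts, and it lies in batch \<open>s\<close>; the centre is
      thus the basis vector of \<open>s\<close>, and averaging over \<open>s\<close> gives
      \<open>P_bb\<close>.\<close>
    have "queried x (bins T (length x) (b(0 := s))) t = (\<Sum>k\<in>{0::nat} \<inter> {k. s = t}. 1)"
      unfolding queried_def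
      by (rule sum.mono_neutral_cong_right)
         (use that in \<open>auto simp: nth_bins len * split: if_splits\<close>)
    thus ?thesis by (auto simp: std_basis_def)
  qed
  have qx': "queried x' S t = 0" for S t
    unfolding queried_def by (intro sum.neutral) (auto simp: x' nth_Cons')
  have "measure (ablq_given T \<sigma> 1 unit_query x (bins T (length x) (b(0 := s)))) \<Delta> =
      measure (gaussian T (std_basis s) \<sigma>) \<Gamma>" for b s
    unfolding given[OF xd(1)]
    by (subst gaussian_cong[of T "queried x (bins T (length x) (b(0 := s)))" "std_basis s", OF qx]) simp_all
  hence "measure (ablq (balls_and_bins T) T \<sigma> 1 unit_query x) \<Delta> =
      measure_pmf.expectation (Pi_pmf ({..<length x} - {0}) 0 (\<lambda>_. pmf_of_set {..<T}))
        (\<lambda>_. measure (P_bb T \<sigma>) \<Gamma>)"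
    using measure_ablq_balls_and_bins[OF \<sigma> T adaptive_query_method_unit_query xd(1) _ \<Delta>, of 0]
    by (simp only: measure_P_bb[OF \<sigma> T \<Gamma>] len zero_less_Suc True_implies_equals)
  hence "measure (ablq (balls_and_bins T) T \<sigma> 1 unit_query x) \<Delta> = measure (P_bb T \<sigma>) \<Gamma>"
    by (simp del: One_nat_def)
  moreover have "measure (ablq_given T \<sigma> 1 unit_query x' S) \<Delta> = measure (Q_bb T \<sigma>) \<Gamma>" for S
    unfolding given[OF xd(2)] Q_bb_def
    by (subst gaussian_cong[of T "queried x' S" "\<lambda>_. 0", OF qx']) simp_all
  hence "measure (ablq (balls_and_bins T) T \<sigma> 1 unit_query x') \<Delta> =
      measure_pmf.expectation (Pi_pmf ({..<length x'} - {0}) 0 (\<lambda>_. pmf_of_set {..<T}))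
        (\<lambda>_. \<Sum>s<T. 1 / real T * measure (Q_bb T \<sigma>) \<Gamma>)"
    using measure_ablq_balls_and_bins[OF \<sigma> T adaptive_query_method_unit_query xd(2) _ \<Delta>, of 0]
    by (simp only: len zero_less_Suc True_implies_equals)
  hence "measure (ablq (balls_and_bins T) T \<sigma> 1 unit_query x') \<Delta> = measure (Q_bb T \<sigma>) \<Gamma>"
    using T by (simp del: One_nat_def)
  moreover have "measure (ablq (balls_and_bins T) T \<sigma> 1 unit_query x) \<Delta> -
      c * measure (ablq (balls_and_bins T) T \<sigma> 1 unit_query x') \<Delta> \<le>
      hockey_stick c (ablq (balls_and_bins T) T \<sigma> 1 unit_query x) (ablq (balls_and_bins T) T \<sigma> 1 unit_query x')"
    using ablq_prob_space[OF \<sigma> adaptive_query_method_unit_query xd(1)] \<Delta>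
    by (intro hockey_stick_upper c) simp_all
  ultimately show "measure (P_bb T \<sigma>) \<Gamma> - c * measure (Q_bb T \<sigma>) \<Gamma> \<le>
      hockey_stick c (ablq (balls_and_bins T) T \<sigma> 1 unit_query x) (ablq (balls_and_bins T) T \<sigma> 1 unit_query x')"
    by simp
qed auto

theorem theorem3p1:
  fixes \<sigma> :: real and T n :: nat
  assumes "\<sigma> > 0" and "T \<ge> 1" and "n \<ge> 1"
  shows "(\<forall>(X :: 'x set) d A x x'.
           d \<ge> 1 \<longrightarrow> adaptive_query_method d X A \<longrightarrow>
           x \<in> datasets X n \<longrightarrow> x' \<in> datasets X n \<longrightarrow> zeroing_adjacent X x x' \<longrightarrow>
           (\<forall>\<epsilon>. hockey_stick (exp \<epsilon>) (P_bb T \<sigma>) (Q_bb T \<sigma>) \<ge>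
                hockey_stick (exp \<epsilon>) (ablq (balls_and_bins T) T \<sigma> d A x)
                                      (ablq (balls_and_bins T) T \<sigma> d A x'))) \<and>
         (\<exists>(X :: 'x set) d A x x'.
           d \<ge> 1 \<and> adaptive_query_method d X A \<and>
           x \<in> datasets X n \<and> x' \<in> datasets X n \<and> zeroing_adjacent X x x' \<and>
           (\<forall>\<epsilon>. hockey_stick (exp \<epsilon>) (ablq (balls_and_bins T) T \<sigma> d A x)
                                      (ablq (balls_and_bins T) T \<sigma> d A x') \<ge>
                hockey_stick (exp \<epsilon>) (P_bb T \<sigma>) (Q_bb T \<sigma>)))"
proof (intro conjI)
  show "\<forall>(X :: 'x set) d A x x'.
           d \<ge> 1 \<longrightarrow> adaptive_query_method d X A \<longrightarrow>
           x \<in> datasets X n \<longrightarrow> x' \<in> datasets X n \<longrightarrow> zeroing_adjacent X x x' \<longrightarrow>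
           (\<forall>\<epsilon>. hockey_stick (exp \<epsilon>) (P_bb T \<sigma>) (Q_bb T \<sigma>) \<ge>
                hockey_stick (exp \<epsilon>) (ablq (balls_and_bins T) T \<sigma> d A x)
                                      (ablq (balls_and_bins T) T \<sigma> d A x'))"
    \<comment> \<open>\<open>bb_hockey\<close> at \<open>c = exp \<epsilon>\<close> separates the
      two divergences.\<close>
    by (intro allI impI, rule order_trans[OF ablq_hockey_stick_le bb_hockey_le]) (use assms in auto)
next
  obtain m where n: "n = Suc m" using assms(3) by (cases n) auto
  \<comment> \<open>Any element of the type can be the single genuine record;
    \<open>undefined\<close> is one. The other \<open>m = n - 1\<close> records are
    \<open>None\<close> in both data sets.\<close>
  define x :: "'x option list" where "x = Some undefined # replicate m None"
  define x' :: "'x option list" where "x' = None # replicate m None"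
  have "zeroing_adjacent UNIV x x'"
    unfolding zeroing_adjacent_def
    by (intro conjI exI[of _ 0]) (auto simp: x_def x'_def nth_Cons')
  moreover have "x \<in> datasets UNIV n" "x' \<in> datasets UNIV n"
    by (auto simp: x_def x'_def n datasets_def)
  ultimately show "\<exists>(X :: 'x set) d A x x'.
           d \<ge> 1 \<and> adaptive_query_method d X A \<and>
           x \<in> datasets X n \<and> x' \<in> datasets X n \<and> zeroing_adjacent X x x' \<and>
           (\<forall>\<epsilon>. hockey_stick (exp \<epsilon>) (ablq (balls_and_bins T) T \<sigma> d A x)
                                      (ablq (balls_and_bins T) T \<sigma> d A x') \<ge>
                hockey_stick (exp \<epsilon>) (P_bb T \<sigma>) (Q_bb T \<sigma>))"
    using adaptive_query_method_unit_query[of "UNIV :: 'x set"]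
      ablq_hockey_stick_ge[OF assms(1,2) _ x_def x'_def]
    by (intro exI[of _ UNIV] exI[of _ "1::nat"] exI[of _ unit_query] exI[of _ x] exI[of _ x']) auto
qed

end
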